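(* Let $x\in(-1,1)$ be an irrational number. (i) If $s\in(\tfrac12,1)$ and $$\sum_{j=0}^{\infty}\frac{|xT(x)\cdots T^{j-1}(x)|^{s-\frac12}}{|T^j(x)|^{\frac{1-s}{2}}}<\infty,$$ then $F_s(x)$ is convergent and $$F_s(x)=\sum_{j=0}^{\infty}e^{i\frac{\pi}{4}\sum_{\ell=0}^{j-1}\sigma(T^\ell x)}\,|xT(x)\cdots T^{j-1}(x)|^{s-\frac12}\,\Omega_s\big(T^j(x)\big).$$ (ii) If $$\sum_{j=0}^{\infty}\sqrt{|xT(x)\cdots T^{j-1}(x)|}<\infty\quad\text{and}\quad\sum_{j=0}^{\infty}\sqrt{|xT(x)\cdots T^{j-1}(x)|}\,\log\Big(\frac1{|T^j(x)|}\Big)<\infty,$$ then $F_1(x)$ is convergent and $$F_1(x)=\sum_{j=0}^{\infty}e^{i\frac{\pi}{4}\sum_{\ell=0}^{j-1}\sigma(T^\ell x)}\,\sqrt{|xT(x)\cdots T^{j-1}(x)|}\,\Omega_1\big(T^j(x)\big).$$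
   Context: $F_s(x)=\sum_{k=1}^\infty\frac{e^{i\pi k^2x}}{k^s}$ (convergence means convergence of the partial sums). $T:[-1,1]\setminus\{0\}\to[-1,1]$ is $T(x)=-\frac1x \bmod 2$, i.e. $T(x)=-\frac1x-2m$ with $m\in\mathbb Z$ chosen so that the value lies in $(-1,1]$; $T^j$ is the $j$-th iterate, and for $j=0$ the product $xT(x)\cdots T^{j-1}(x)$ is $1$ and the sum $\sum_{\ell=0}^{j-1}$ is $0$. $\sigma(y)=\pm1$ is the sign of $y$. Notation: $\rho=e^{i\pi/4}$; $\{y\}$ is the fractional part; $\log z=\ln|z|+i\arg z$ with $-\pi<\arg z\le\pi$, $z^s=e^{s\log z}$. For $y>0$, $t\in\mathbb R$, $s\ge0$, $$I_s(y,t)=\int_{1/2-\rho\infty}^{1/2+\rho\infty}\frac{e^{i\pi z^2y+2i\pi z\{t\}}}{z^s(1-e^{2i\pi z})}\,dz+\rho y^s\int_{-\infty}^{\infty}e^{-\pi yu^2}\Big(\sum_{k=1}^\infty e^{-i\pi(k-\{t\})^2/y}\Big(\frac{1}{(\rho yu+k-\{t\})^s}-\frac1{k^s}\Big)\Big)du,$$ the first integral over the line $z=\frac12+\rho u$, $u\in\mathbb R$. Then $\Omega_s(y)=I_s(y,0)$ for $y>0$ and $\Omega_s(y)=\overline{I_s(-y,0)}$ for $y<0$. *)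

theory Defs
  imports "HOL-Analysis.Analysis"
begin

definition F_term :: "real \<Rightarrow> real \<Rightarrow> nat \<Rightarrow> complex" where
  "F_term s x k = exp (\<i> * of_real (pi * (real k)\<^sup>2 * x)) / of_real (real k powr s)"

text \<open>The summation index starts at 1, hence the shift by \<open>Suc\<close>.\<close>

definition F_convergent :: "real \<Rightarrow> real \<Rightarrow> bool" where
  "F_convergent s x \<longleftrightarrow> summable (\<lambda>k. F_term s x (Suc k))"

definition F :: "real \<Rightarrow> real \<Rightarrow> complex" where
  "F s x = (\<Sum>k. F_term s x (Suc k))"

text \<open>\<open>- 1 / x\<close> reduced modulo 2 to \<open>(-1, 1]\<close>; only meaningful for \<open>x \<noteq> 0\<close>.\<close>

definition T :: "real \<Rightarrow> real" where
  "T x = - 1 / x - 2 * of_int \<lceil>(- 1 / x - 1) / 2\<rceil>"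

lemma T_range: "- 1 < T x \<and> T x \<le> 1"
proof -
  define y where "y = (- 1 / x - 1) / 2"
  have "T x = 2 * y + 1 - 2 * of_int \<lceil>y\<rceil>"
    unfolding T_def y_def by (simp add: diff_divide_distrib)
  thus ?thesis using ceiling_correct[of y] by linarith
qed

lemma T_unique:
  assumes "r = - 1 / x - 2 * of_int m" "- 1 < r" "r \<le> 1"
  shows "T x = r"
proof -
  have "\<lceil>(- 1 / x - 1) / 2\<rceil> = m"
    using assms by (intro ceiling_unique) auto
  thus ?thesis using assms(1) by (simp add: T_def)
qed

definition orbit_prod :: "real \<Rightarrow> nat \<Rightarrow> real" where
  "orbit_prod x j = (\<Prod>l<j. (T ^^ l) x)"

definition phase :: "real \<Rightarrow> nat \<Rightarrow> complex" where
  "phase x j = exp (\<i> * of_real (pi / 4 * (\<Sum>l<j. sgn ((T ^^ l) x))))"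

definition rho :: complex where
  "rho = exp (\<i> * of_real (pi / 4))"

definition line_integrand :: "real \<Rightarrow> real \<Rightarrow> real \<Rightarrow> complex \<Rightarrow> complex" where
  "line_integrand s y t z =
     exp (\<i> * of_real pi * z\<^sup>2 * of_real y + 2 * \<i> * of_real pi * z * of_real (frac t))
       / (z powr of_real s * (1 - exp (2 * \<i> * of_real pi * z)))"

definition series_integrand :: "real \<Rightarrow> real \<Rightarrow> real \<Rightarrow> real \<Rightarrow> complex" where
  "series_integrand s y t u =
     of_real (exp (- pi * y * u\<^sup>2)) *
     (\<Sum>n. let k = real (Suc n) in
        exp (- \<i> * of_real (pi * (k - frac t)\<^sup>2 / y)) *
        (1 / (rho * of_real (y * u) + of_real (k - frac t)) powr of_real s
          - 1 / of_real (k powr s)))"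

text \<open>The line integral is parametrised by \<open>z = 1/2 + \<rho> u\<close>, so \<open>dz = \<rho> du\<close>. The Gaussian
  factors make both integrals absolutely convergent for \<open>y > 0\<close>, \<open>s \<ge> 0\<close>.\<close>

definition I :: "real \<Rightarrow> real \<Rightarrow> real \<Rightarrow> complex" where
  "I s y t =
     (LINT u|lborel. line_integrand s y t (1 / 2 + rho * of_real u) * rho)
     + rho * of_real (y powr s) * (LINT u|lborel. series_integrand s y t u)"

text \<open>The value at \<open>y = 0\<close> is a dummy.\<close>

definition Omega :: "real \<Rightarrow> real \<Rightarrow> complex" where
  "Omega s y = (if y > 0 then I s y 0 else if y < 0 then cnj (I s (- y) 0) else 0)"

end

theory Submission
  imports Defs "HOL-Complex_Analysis.Complex_Analysis" "HOL-Probability.Probability"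
    "HOL-Real_Asymp.Real_Asymp"
begin

text \<open>
  For \<open>0 < y \<le> 1\<close> and \<open>f z = exp (i \<pi> y z\<^sup>2) / (z\<^sup>s (1 - exp (2 i \<pi> z)))\<close>, the residue theorem writes the
  partial sum of length \<open>m\<close> of \<open>F\<^sub>s(y)\<close> as the integral of \<open>f\<close> over the line \<open>1/2 + \<rho> u\<close> minus that over
  \<open>m + 1/2 + \<rho> u\<close>. On the second line, expanding
  \<open>1/(1 - q) = - q\<^sup>-\<^sup>1 - \<dots> - q\<^sup>-\<^sup>K + q\<^sup>-\<^sup>K/(1 - q)\<close> with \<open>q = exp (2 i \<pi> z)\<close> and \<open>K = \<lfloor>m y\<rfloor>\<close>, and moving the
  \<open>k\<close>-th term to the line through its saddle point \<open>k/y\<close>, produces \<open>\<rho> y powr (s - 1/2)\<close> times the partial sum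
  of length \<open>K\<close> of \<open>F\<^sub>s(-1/y)\<close>, the beginning of the series in \<open>\<Omega>\<^sub>s(y)\<close>, and a remainder. The remainder tends
  to 0 as \<open>m\<close> grows, and uniformly in \<open>m\<close> it is \<open>O(y powr (-(1 - s)/2))\<close>, or \<open>O(1 + ln (1/y))\<close> if \<open>s = 1\<close>.
  Iterating this approximate functional equation along the orbit of \<open>T\<close> until the partial sum is empty writes
  the partial sums of \<open>F\<^sub>s(x)\<close> as finite sums to which Tannery's theorem applies.
\<close>

subsection \<open>Contour integrals over parallel lines\<close>

lemma has_contour_integral_horizontal:
  fixes f :: "complex \<Rightarrow> complex" and a b c :: real
  assumes "a < b" and "((\<lambda>u. f (Complex u c)) has_integral J) {a..b}"
  shows "(f has_contour_integral J) (linepath (Complex a c) (Complex b c))"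
proof -
  have "((\<lambda>t. f (Complex ((b - a) *\<^sub>R t + a) c)) has_integral J /\<^sub>R (b - a) ^ DIM(real))
          (cbox ((a - a) /\<^sub>R (b - a)) ((b - a) /\<^sub>R (b - a)))"
    using assms by (intro has_integral_affinity') auto
  hence "((\<lambda>t. f (Complex ((b - a) * t + a) c)) has_integral J / (b - a)) {0..1}"
    using assms by (simp add: scaleR_conv_of_real field_simps)
  hence "((\<lambda>t. f (Complex ((b - a) * t + a) c) * (b - a)) has_integral J / (b - a) * (b - a)) {0..1}"
    by (rule has_integral_mult_left)
  hence "((\<lambda>t. f (Complex ((b - a) * t + a) c) * (b - a)) has_integral J) {0..1}"
    using assms by simp
  moreover have "linepath (Complex a c) (Complex b c) t = Complex ((b - a) * t + a) c" for t
    by (simp add: linepath_def complex_eq_iff algebra_simps)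
  moreover have "Complex b c - Complex a c = of_real (b - a)"
    by (simp add: complex_eq_iff)
  ultimately show ?thesis
    by (simp add: has_contour_integral_linepath del: of_real_diff)
qed

text \<open>Dominated convergence, with the norm of the integrand as majorant. This is the passage
  from finite rectangles to whole lines in the residue computation.\<close>

lemma integral_symmetric_interval_tendsto:
  fixes f :: "real \<Rightarrow> complex"
  assumes f: "integrable lborel f"
  shows "(\<lambda>n. integral {- real n..real n} f) \<longlonglongrightarrow> (LINT u|lborel. f u)"
    and "f integrable_on {- real n..real n}"
proof -
  have si: "set_integrable lborel {- real n..real n} f" for n
    unfolding set_integrable_def using f by (intro integrable_mult_indicator) auto
  show "f integrable_on {- real n..real n}"
    using set_borel_integral_eq_integral(1)[OF si] .
  have eq: "integral {- real n..real n} f = (LINT u|lborel. indicator {- real n..real n} u *\<^sub>R f u)" for n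
    using set_borel_integral_eq_integral(2)[OF si, of n] by (simp add: set_lebesgue_integral_def)
  show "(\<lambda>n. integral {- real n..real n} f) \<longlonglongrightarrow> (LINT u|lborel. f u)"
    unfolding eq
  proof (rule integral_dominated_convergence)
    show "integrable lborel (\<lambda>u. norm (f u))" using f by simp
    show "AE u in lborel. (\<lambda>n. indicator {- real n..real n} u *\<^sub>R f u) \<longlonglongrightarrow> f u"
    proof (intro AE_I2)
      fix u :: real
      obtain N where N: "\<bar>u\<bar> \<le> real N" using real_arch_simple by blast
      have "eventually (\<lambda>n. indicator {- real n..real n} u *\<^sub>R f u = f u) sequentially"
        using eventually_ge_at_top[of N]
      proof eventually_elim
        case (elim n)
        hence "real N \<le> real n" by simp
        with N have "u \<in> {- real n..real n}" by auto
        thus ?case by simp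
      qed
      thus "(\<lambda>n. indicator {- real n..real n} u *\<^sub>R f u) \<longlonglongrightarrow> f u"
        by (rule tendsto_eventually)
    qed
    show "AE u in lborel. norm (indicator {- real n..real n} u *\<^sub>R f u) \<le> norm (f u)" for n
      by (auto simp: indicator_def)
  qed (use f in auto)
qed

text \<open>Cauchy's integral formula on rectangles of half-width \<open>n\<close>, with
  \<open>n\<close> tending to infinity; the bound \<open>B\<close> kills the two vertical sides. The
  simple pole at 0 is presented as \<open>h w / w\<close> with \<open>h\<close> holomorphic, so the
  residue is just \<open>h 0\<close>.\<close>

lemma horizontal_line_residue:
  fixes h :: "complex \<Rightarrow> complex" and b t :: real
  assumes bt: "b < 0" "0 < t"
    and hol: "h holomorphic_on {w. b \<le> Im w \<and> Im w \<le> t}"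
    and intb: "integrable lborel (\<lambda>u. h (Complex u b) / Complex u b)"
    and intt: "integrable lborel (\<lambda>u. h (Complex u t) / Complex u t)"
    and bound: "\<And>u v. U \<le> \<bar>u\<bar> \<Longrightarrow> b \<le> v \<Longrightarrow> v \<le> t \<Longrightarrow>
                  norm (h (Complex u v) / Complex u v) \<le> B \<bar>u\<bar>"
    and B: "(B \<longlongrightarrow> 0) at_top"
  shows "(LINT u|lborel. h (Complex u b) / Complex u b)
         - (LINT u|lborel. h (Complex u t) / Complex u t) = 2 * of_real pi * \<i> * h 0"
proof -
  let ?f = "\<lambda>w. h w / (w - 0)"
  let ?S = "{w. b \<le> Im w \<and> Im w \<le> t}"
  \<comment> \<open>Net contribution of the right and left sides, both parametrised upwards.\<close>
  define V where "V n = contour_integral (linepath (Complex n b) (Complex n t)) ?f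
     - contour_integral (linepath (Complex (-n) b) (Complex (-n) t)) ?f" for n :: real
  have conv: "convex ?S"
  proof -
    have "?S = Im -` {b..t}" by auto
    moreover have "convex (Im -` {b..t})"
      by (intro convex_linear_vimage) (auto simp: bounded_linear.linear bounded_linear_Im)
    ultimately show ?thesis by simp
  qed
  have int0: "0 \<in> interior ?S"
  proof -
    have "open {w. b < Im w \<and> Im w < t}"
      by (intro open_Collect_conj open_Collect_less continuous_intros)
    moreover have "{w. b < Im w \<and> Im w < t} \<subseteq> ?S" by auto
    ultimately show ?thesis using bt by (intro interiorI[of "{w. b < Im w \<and> Im w < t}"]) auto
  qed
  have cont: "continuous_on (?S - {0}) ?f"
    by (intro continuous_intros continuous_on_subset[OF holomorphic_on_imp_continuous_on[OF hol]]) auto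
  have segint: "?f contour_integrable_on linepath p q"
    if "closed_segment p q \<subseteq> ?S - {0}" for p q
    by (intro contour_integrable_continuous_linepath continuous_on_subset[OF cont] that)
  have vert: "closed_segment (Complex c b) (Complex c t) = {w. Re w = c \<and> b \<le> Im w \<and> Im w \<le> t}" for c
    using bt by (subst closed_segment_same_Re) (auto simp: closed_segment_eq_real_ivl)
  have main: "integral {- real n..real n} (\<lambda>u. h (Complex u b) / Complex u b)
      - integral {- real n..real n} (\<lambda>u. h (Complex u t) / Complex u t) + V (real n)
      = 2 * of_real pi * \<i> * h 0" if n: "n > 0" for n
  proof -
    let ?a = "Complex (- real n) b" and ?c = "Complex (real n) t"
    let ?p = "Complex (real n) b" and ?q = "Complex (- real n) t"
    have "(?f has_contour_integral (2*pi * \<i> * winding_number (rectpath ?a ?c) 0 * h 0)) (rectpath ?a ?c)"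
      using n bt by (intro Cauchy_integral_formula_convex_simple[OF conv hol int0])
        (auto simp: path_image_rectpath)
    moreover have "winding_number (rectpath ?a ?c) 0 = 1"
      using n bt by (intro winding_number_rectpath) (auto simp: in_box_complex_iff)
    ultimately have 1: "(?f has_contour_integral (2*pi * \<i> * h 0)) (rectpath ?a ?c)" by simp
    have ib: "(?f has_contour_integral integral {- real n..real n} (\<lambda>u. h (Complex u b) / Complex u b)) (linepath ?a ?p)"
      using n integral_symmetric_interval_tendsto(2)[OF intb, of n]
      by (intro has_contour_integral_horizontal) (auto intro: integrable_integral)
    have "(?f has_contour_integral integral {- real n..real n} (\<lambda>u. h (Complex u t) / Complex u t)) (linepath ?q ?c)"
      using n integral_symmetric_interval_tendsto(2)[OF intt, of n]
      by (intro has_contour_integral_horizontal) (auto intro: integrable_integral)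
    hence it: "(?f has_contour_integral - integral {- real n..real n} (\<lambda>u. h (Complex u t) / Complex u t)) (linepath ?c ?q)"
      by (metis has_contour_integral_reversepath reversepath_linepath valid_path_linepath)
    have ir: "(?f has_contour_integral contour_integral (linepath ?p ?c) ?f) (linepath ?p ?c)"
      using n by (intro has_contour_integral_integral segint) (auto simp: vert)
    have "(?f has_contour_integral contour_integral (linepath ?a ?q) ?f) (linepath ?a ?q)"
      using n by (intro has_contour_integral_integral segint) (auto simp: vert)
    hence il: "(?f has_contour_integral - contour_integral (linepath ?a ?q) ?f) (linepath ?q ?a)"
      by (metis has_contour_integral_reversepath reversepath_linepath valid_path_linepath)
    have "(?f has_contour_integral (integral {- real n..real n} (\<lambda>u. h (Complex u b) / Complex u b)
       + (contour_integral (linepath ?p ?c) ?f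
       + (- integral {- real n..real n} (\<lambda>u. h (Complex u t) / Complex u t)
       + - contour_integral (linepath ?a ?q) ?f)))) (rectpath ?a ?c)"
      unfolding rectpath_def Let_def using ib ir it il
      by (intro has_contour_integral_join) (auto intro!: valid_path_join)
    from has_contour_integral_unique[OF this 1] show ?thesis
      unfolding V_def by (simp add: algebra_simps)
  qed
  have Vlim: "(\<lambda>n. V (real n)) \<longlonglongrightarrow> 0"
  proof (rule Lim_null_comparison)
    show "eventually (\<lambda>n. norm (V (real n)) \<le> 2 * (B (real n) * (t - b))) sequentially"
      using filterlim_real_sequentially[THEN filterlim_at_top[THEN iffD1], rule_format, of "max U 1"]
    proof eventually_elim
      case (elim n)
      have seg: "norm (contour_integral (linepath (Complex c b) (Complex c t)) ?f)
             \<le> B (real n) * norm (Complex c t - Complex c b)" if c: "\<bar>c\<bar> = real n" for c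
      proof (rule contour_integral_bound_linepath)
        show "?f contour_integrable_on linepath (Complex c b) (Complex c t)"
          using elim c by (intro segint) (auto simp: vert)
        have bd: "norm (h (Complex c v) / Complex c v) \<le> B (real n)" if "b \<le> v" "v \<le> t" for v
          using bound[of c v] that c elim by auto
        show "norm (?f x) \<le> B (real n)" if "x \<in> closed_segment (Complex c b) (Complex c t)" for x
          using bd[of "Im x"] that unfolding vert by (metis (mono_tags, lifting) complex.exhaust_sel diff_zero mem_Collect_eq)
        \<comment> \<open>\<open>B (real n) \<ge> 0\<close> comes from the bound itself, read at
          height 0, which lies between \<open>b\<close> and \<open>t\<close>.\<close>
        have "0 \<le> norm (h (Complex c 0) / Complex c 0)" by (rule norm_ge_zero)
        thus "0 \<le> B (real n)" using bd[of 0] bt by linarith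
      qed
      have nd: "norm (Complex c t - Complex c b) = t - b" for c
        using bt by (simp add: cmod_def)
      have "norm (V (real n)) \<le> norm (contour_integral (linepath (Complex n b) (Complex n t)) ?f)
         + norm (contour_integral (linepath (Complex (- real n) b) (Complex (- real n) t)) ?f)"
        unfolding V_def by (rule norm_triangle_ineq4)
      thus ?case using seg[of "real n"] seg[of "- real n"] unfolding nd by simp
    qed
    have "(\<lambda>n. 2 * (B (real n) * (t - b))) \<longlonglongrightarrow> 2 * (0 * (t - b))"
      by (intro tendsto_intros filterlim_compose[OF B filterlim_real_sequentially])
    thus "(\<lambda>n. 2 * (B (real n) * (t - b))) \<longlonglongrightarrow> 0" by simp
  qed
  have "(\<lambda>n. integral {- real n..real n} (\<lambda>u. h (Complex u b) / Complex u b)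
      - integral {- real n..real n} (\<lambda>u. h (Complex u t) / Complex u t) + V (real n))
      \<longlonglongrightarrow> (LINT u|lborel. h (Complex u b) / Complex u b)
         - (LINT u|lborel. h (Complex u t) / Complex u t) + 0"
    by (intro tendsto_intros Vlim integral_symmetric_interval_tendsto(1) intb intt)
  moreover have "(\<lambda>n. integral {- real n..real n} (\<lambda>u. h (Complex u b) / Complex u b)
      - integral {- real n..real n} (\<lambda>u. h (Complex u t) / Complex u t) + V (real n))
      \<longlonglongrightarrow> 2 * of_real pi * \<i> * h 0"
    using main by (intro tendsto_eventually eventually_sequentiallyI[of 1]) auto
  ultimately show ?thesis using LIMSEQ_unique by fastforce
qed

section \<open>Slanted lines through real points\<close>

text \<open>For \<open>y > 0\<close>, \<open>exp (i pi y z^2)\<close> decays like a Gaussian in this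
  direction. The line is the level set \<open>Re z - Im z = a\<close>, which explains the shape of
  the strips below.\<close>

definition slant :: "real \<Rightarrow> real \<Rightarrow> complex" where
  "slant a u = of_real a + rho * of_real u"

lemma rho_eq: "rho = Complex (sqrt 2 / 2) (sqrt 2 / 2)"
  by (simp add: rho_def exp_eq_polar cis.ctr cos_45 sin_45 flip: of_real_mult)

lemma norm_rho [simp]: "norm rho = 1"
  by (simp add: rho_def)

lemma rho_nonzero [simp]: "rho \<noteq> 0"
  by (simp add: rho_def)

lemma Re_slant [simp]: "Re (slant a u) = a + sqrt 2 / 2 * u"
  and Im_slant [simp]: "Im (slant a u) = sqrt 2 / 2 * u"
  by (simp_all add: slant_def rho_eq)

text \<open>The distance from 0 to this line is \<open>|a| / sqrt 2\<close>, and the imaginary part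
  alone has modulus \<open>|u| / sqrt 2\<close>; both are rounded down to halves.\<close>

lemma norm_slant_ge: "\<bar>a\<bar> / 2 \<le> norm (slant a u)" "\<bar>u\<bar> / 2 \<le> norm (slant a u)"
proof -
  have n: "(norm (slant a u))\<^sup>2 = (a + sqrt 2 / 2 * u)\<^sup>2 + (sqrt 2 / 2 * u)\<^sup>2"
    by (simp add: cmod_power2)
  have s: "(sqrt 2 / 2 * u)\<^sup>2 = u\<^sup>2 / 2"
    by (simp add: power2_eq_square field_simps)
  have n2: "(norm (slant a u))\<^sup>2 = (sqrt 2 / 2 * a + u)\<^sup>2 + a\<^sup>2 / 2"
    unfolding n by (simp add: power2_eq_square field_simps)
  have "(\<bar>u\<bar> / 2)\<^sup>2 \<le> (norm (slant a u))\<^sup>2"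
    unfolding n s by (simp add: power_divide add_increasing)
  thus "\<bar>u\<bar> / 2 \<le> norm (slant a u)" by (rule power2_le_imp_le) simp
  have "(\<bar>a\<bar> / 2)\<^sup>2 \<le> (norm (slant a u))\<^sup>2"
    unfolding n2 by (simp add: power_divide add_increasing)
  thus "\<bar>a\<bar> / 2 \<le> norm (slant a u)" by (rule power2_le_imp_le) simp
qed

lemma slant_notin_nonpos: "a > 0 \<Longrightarrow> slant a u \<notin> \<real>\<^sub>\<le>\<^sub>0"
  by (auto simp: complex_nonpos_Reals_iff)

lemma slant_nonzero: "a > 0 \<Longrightarrow> slant a u \<noteq> 0"
  using norm_slant_ge(1)[of a u] by auto

lemma continuous_on_slant [continuous_intros]: "continuous_on A (slant a)"
  unfolding slant_def by (intro continuous_intros)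

text \<open>The substitution \<open>z = p + rho w\<close> turns slanted lines into horizontal ones
  and the pole \<open>p\<close> into 0: height \<open>v\<close> corresponds to the line through
  \<open>p - sqrt 2 * v\<close>. Hence the right-hand line \<open>a2\<close> becomes the lower edge,
  which fixes the sign.\<close>

lemma slant_line_residue:
  fixes h :: "complex \<Rightarrow> complex"
  assumes p: "a1 < p" "p < a2"
    and hol: "h holomorphic_on {z. a1 \<le> Re z - Im z \<and> Re z - Im z \<le> a2}"
    and int1: "integrable lborel (\<lambda>u. h (slant a1 u) / (slant a1 u - of_real p))"
    and int2: "integrable lborel (\<lambda>u. h (slant a2 u) / (slant a2 u - of_real p))"
    and bound: "\<And>a u. a1 \<le> a \<Longrightarrow> a \<le> a2 \<Longrightarrow> U \<le> \<bar>u\<bar> \<Longrightarrow>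
                  norm (h (slant a u) / (slant a u - of_real p)) \<le> M * exp (- (d * u\<^sup>2))"
    and d: "d > 0" "M \<ge> 0"
  shows "(LINT u|lborel. h (slant a2 u) / (slant a2 u - of_real p) * rho)
         - (LINT u|lborel. h (slant a1 u) / (slant a1 u - of_real p) * rho) = 2 * of_real pi * \<i> * h p"
proof -
  define g where "g w = h (of_real p + rho * w)" for w
  define b t where "b = (p - a2) / sqrt 2" and "t = (p - a1) / sqrt 2"
  \<comment> \<open>At height \<open>v\<close> the parameter on the slanted line is
    \<open>v + u\<close>; \<open>c\<close> bounds \<open>|v|\<close>, so \<open>|u| - c\<close> is a
    lower bound for its modulus.\<close>
  define c where "c = t - b"
  have bt: "b < 0" "0 < t" using p by (auto simp: b_def t_def field_simps)
  \<comment> \<open>The form \<open>v + 1 * u\<close> matches the affine substitution rule for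
    Lebesgue integrals.\<close>
  have sl: "of_real p + rho * Complex u v = slant (p - sqrt 2 * v) (v + 1 * u)" for u v
    by (simp add: complex_eq_iff rho_eq) (simp add: algebra_simps)
  have slb: "of_real p + rho * Complex u b = slant a2 (b + 1 * u)"
    and slt: "of_real p + rho * Complex u t = slant a1 (t + 1 * u)" for u
    unfolding sl by (simp_all add: b_def t_def)
  have quot: "g (Complex u v) / Complex u v =
     h (of_real p + rho * Complex u v) / (of_real p + rho * Complex u v - of_real p) * rho" for u v
    by (simp add: g_def)
  have hol': "g holomorphic_on {w. b \<le> Im w \<and> Im w \<le> t}"
  proof -
    have "h \<circ> (\<lambda>w. of_real p + rho * w) holomorphic_on {w. b \<le> Im w \<and> Im w \<le> t}"
    proof (rule holomorphic_on_compose_gen[OF _ hol])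
      show "(\<lambda>w. of_real p + rho * w) ` {w. b \<le> Im w \<and> Im w \<le> t}
              \<subseteq> {z. a1 \<le> Re z - Im z \<and> Re z - Im z \<le> a2}"
      proof (rule image_subsetI)
        fix w assume "w \<in> {w. b \<le> Im w \<and> Im w \<le> t}"
        hence w: "b \<le> Im w" "Im w \<le> t" by auto
        have e: "of_real p + rho * w = slant (p - sqrt 2 * Im w) (Im w + 1 * Re w)"
          using sl[of "Re w" "Im w"] by simp
        have "sqrt 2 * b \<le> sqrt 2 * Im w" "sqrt 2 * Im w \<le> sqrt 2 * t"
          using w by (auto intro!: mult_left_mono)
        thus "of_real p + rho * w \<in> {z. a1 \<le> Re z - Im z \<and> Re z - Im z \<le> a2}"
          unfolding e by (simp add: b_def t_def)
      qed
    qed (intro holomorphic_intros)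
    thus ?thesis by (simp add: g_def[abs_def] o_def)
  qed
  have "(LINT u|lborel. g (Complex u b) / Complex u b) - (LINT u|lborel. g (Complex u t) / Complex u t)
        = 2 * of_real pi * \<i> * g 0"
  proof (rule horizontal_line_residue[OF bt hol'])
    show "integrable lborel (\<lambda>u. g (Complex u b) / Complex u b)"
      unfolding quot slb by (intro integrable_mult_left lborel_integrable_real_affine int2) auto
    show "integrable lborel (\<lambda>u. g (Complex u t) / Complex u t)"
      unfolding quot slt by (intro integrable_mult_left lborel_integrable_real_affine int1) auto
    show "norm (g (Complex u v) / Complex u v) \<le> M * exp (- (d * (\<bar>u\<bar> - c)\<^sup>2))"
      if "\<bar>U\<bar> + c \<le> \<bar>u\<bar>" "b \<le> v" "v \<le> t" for u v
    proof -
      have uv: "\<bar>u\<bar> - c \<le> \<bar>v + 1 * u\<bar>" using that bt by (auto simp: c_def)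
      have "sqrt 2 * b \<le> sqrt 2 * v" "sqrt 2 * v \<le> sqrt 2 * t"
        using that by (auto intro!: mult_left_mono)
      hence "norm (h (slant (p - sqrt 2 * v) (v + 1 * u)) / (slant (p - sqrt 2 * v) (v + 1 * u) - of_real p))
          \<le> M * exp (- (d * (v + 1 * u)\<^sup>2))"
        using that uv by (intro bound) (auto simp: b_def t_def)
      also have "(\<bar>u\<bar> - c)\<^sup>2 \<le> (v + 1 * u)\<^sup>2"
        using uv that by (intro abs_le_square_iff[THEN iffD1]) auto
      hence "M * exp (- (d * (v + 1 * u)\<^sup>2)) \<le> M * exp (- (d * (\<bar>u\<bar> - c)\<^sup>2))"
        using d by (intro mult_left_mono) auto
      finally show ?thesis by (simp only: quot sl norm_mult norm_rho mult_1_right)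
    qed
    have "((\<lambda>r. exp (- (d * (r - c)\<^sup>2))) \<longlongrightarrow> 0) at_top"
      using d by real_asymp
    thus "((\<lambda>r. M * exp (- (d * (r - c)\<^sup>2))) \<longlongrightarrow> 0) at_top"
      by (rule tendsto_mult_right_zero)
  qed
  also have "(LINT u|lborel. g (Complex u b) / Complex u b)
     = (LINT u|lborel. h (slant a2 u) / (slant a2 u - of_real p) * rho)"
    unfolding quot slb
    by (subst lborel_integral_real_affine[where c = 1 and t = b and f = "\<lambda>u. h (slant a2 u) / (slant a2 u - of_real p) * rho"]) auto
  also have "(LINT u|lborel. g (Complex u t) / Complex u t)
     = (LINT u|lborel. h (slant a1 u) / (slant a1 u - of_real p) * rho)"
    unfolding quot slt
    by (subst lborel_integral_real_affine[where c = 1 and t = t and f = "\<lambda>u. h (slant a1 u) / (slant a1 u - of_real p) * rho"]) auto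
  finally show ?thesis by (simp add: g_def)
qed

lemma slant_line_shift:
  fixes f :: "complex \<Rightarrow> complex"
  assumes a: "a1 < a2"
    and hol: "f holomorphic_on {z. a1 \<le> Re z - Im z \<and> Re z - Im z \<le> a2}"
    and int1: "integrable lborel (\<lambda>u. f (slant a1 u))"
    and int2: "integrable lborel (\<lambda>u. f (slant a2 u))"
    and bound: "\<And>a u. a1 \<le> a \<Longrightarrow> a \<le> a2 \<Longrightarrow> norm (f (slant a u)) \<le> M * exp (- (d * u\<^sup>2))"
    and d: "d > 0" "M \<ge> 0"
  shows "(LINT u|lborel. f (slant a1 u) * rho) = (LINT u|lborel. f (slant a2 u) * rho)"
proof -
  \<comment> \<open>The residue lemma applied to a function vanishing at its artificial pole \<open>p\<close>.\<close>
  define p where "p = (a1 + a2) / 2"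
  define h where "h z = f z * (z - of_real p)" for z
  have p: "a1 < p" "p < a2" using a by (auto simp: p_def)
  have nz: "slant a u \<noteq> of_real p" if "a \<noteq> p" for a u
    using that by (auto simp: complex_eq_iff)
  have q: "h (slant a u) / (slant a u - of_real p) = f (slant a u)" if "a \<noteq> p" for a u
    using nz[OF that] by (simp add: h_def)
  have "(LINT u|lborel. h (slant a2 u) / (slant a2 u - of_real p) * rho)
         - (LINT u|lborel. h (slant a1 u) / (slant a1 u - of_real p) * rho) = 2 * of_real pi * \<i> * h p"
  proof (rule slant_line_residue[OF p _ _ _ _ d])
    show "h holomorphic_on {z. a1 \<le> Re z - Im z \<and> Re z - Im z \<le> a2}"
      unfolding h_def by (intro holomorphic_intros hol)
    show "norm (h (slant a u) / (slant a u - of_real p)) \<le> M * exp (- (d * u\<^sup>2))"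
      if "a1 \<le> a" "a \<le> a2" for a u
    proof (cases "slant a u = of_real p")
      case False
      thus ?thesis using bound[OF that, of u] by (simp add: h_def)
    qed (use d in auto)
  qed (use p int1 int2 in \<open>simp_all add: q\<close>)
  moreover have ne: "a1 \<noteq> p" "a2 \<noteq> p" using p by auto
  ultimately have "(LINT u|lborel. f (slant a2 u) * rho) - (LINT u|lborel. f (slant a1 u) * rho)
      = 2 * of_real pi * \<i> * h p" by (simp only: q[OF ne(1)] q[OF ne(2)])
  thus ?thesis by (simp add: h_def)
qed

subsection \<open>The kernel and its residues\<close>

lemma gaussian_integral:
  assumes "c > 0"
  shows "has_bochner_integral lborel (\<lambda>u. exp (- (pi * c * u\<^sup>2))) (1 / sqrt c)"
proof -
  \<comment> \<open>Chosen so that the centred normal density with deviation \<open>\<sigma>\<close>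
    is \<open>sqrt c * exp (- (pi * c * u^2))\<close>; its zeroth moment 1 then gives the
    integral.\<close>
  define \<sigma> where "\<sigma> = sqrt (1 / (2 * pi * c))"
  have \<sigma>: "\<sigma> > 0" "\<sigma>\<^sup>2 = 1 / (2 * pi * c)" using assms by (auto simp: \<sigma>_def)
  have "has_bochner_integral lborel (\<lambda>x. 1 / sqrt c * (normal_density 0 \<sigma> x * (x - 0) ^ (2 * 0)))
     (1 / sqrt c * (fact (2 * 0) / ((2 / \<sigma>\<^sup>2) ^ 0 * fact 0)))"
    by (intro has_bochner_integral_mult_right normal_moment_even \<sigma>)
  moreover have "1 / sqrt c * (normal_density 0 \<sigma> x * (x - 0) ^ (2 * 0)) = exp (- (pi * c * x\<^sup>2))" for x
    using assms by (simp add: normal_density_def \<sigma> real_sqrt_divide field_simps)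
  ultimately show ?thesis by simp
qed

lemma integrable_gaussian_bound:
  fixes f :: "real \<Rightarrow> complex"
  assumes "continuous_on UNIV f" "c > 0" "\<And>u. norm (f u) \<le> M * exp (- (pi * c * u\<^sup>2))"
  shows "integrable lborel f"
proof (rule Bochner_Integration.integrable_bound)
  show "integrable lborel (\<lambda>u. M * exp (- (pi * c * u\<^sup>2)))"
    using gaussian_integral[OF assms(2)] by (intro integrable_mult_right) (auto simp: integrable.simps)
  show "f \<in> borel_measurable lborel"
    using borel_measurable_continuous_onI[OF assms(1)] by simp
  show "AE u in lborel. norm (f u) \<le> norm (M * exp (- (pi * c * u\<^sup>2)))"
    using assms(3) by (intro AE_I2) (smt (verit) real_norm_def)
qed

text \<open>The numerator exponential of \<open>f\<close> times \<open>q powr (- k)\<close>, where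
  \<open>q = exp (2 i pi z)\<close>. The exponent has its only critical point, the saddle, at
  \<open>z = k / y\<close>.\<close>

definition chirp :: "real \<Rightarrow> nat \<Rightarrow> complex \<Rightarrow> complex" where
  "chirp y k z = exp (\<i> * of_real pi * z\<^sup>2 * of_real y - 2 * \<i> * of_real pi * of_nat k * z)"

definition kern :: "real \<Rightarrow> real \<Rightarrow> nat \<Rightarrow> complex \<Rightarrow> complex" where
  "kern s y k z = chirp y k z / z powr of_real s"

definition den :: "complex \<Rightarrow> complex" where
  "den z = 1 - exp (2 * \<i> * of_real pi * z)"

text \<open>Since \<open>rho^2 = i\<close>, the quadratic part of the exponent becomes real in
  \<open>u\<close>. The linear part has coefficient proportional to \<open>y * a - k\<close>, which
  vanishes exactly on the line through the saddle.\<close>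

lemma norm_chirp:
  "norm (chirp y k (slant a u)) = exp (- (pi * y * u\<^sup>2) - sqrt 2 * pi * (y * a - k) * u)"
proof -
  have "Re (\<i> * of_real pi * z\<^sup>2 * of_real y - 2 * \<i> * of_real pi * of_nat k * z)
     = - (pi * y * (2 * Re z * Im z)) + 2 * pi * k * Im z" for z
    by (simp add: power2_eq_square algebra_simps)
  thus ?thesis
    by (simp add: chirp_def power2_eq_square algebra_simps)
qed

text \<open>Half of the Gaussian absorbs the linear term:
  \<open>(D - y |u| / sqrt 2)^2 \<ge> 0\<close> bounds \<open>sqrt 2 * D * |u|\<close> by
  \<open>D^2 / y + y / 2 * u^2\<close>. The estimate is uniform over all lines with the same
  \<open>D\<close>, as shifting requires.\<close>

lemma norm_chirp_le:
  assumes y: "y > 0" and D: "\<bar>y * a - k\<bar> \<le> D"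
  shows "norm (chirp y k (slant a u)) \<le> exp (pi * D\<^sup>2 / y) * exp (- (pi * (y / 2) * u\<^sup>2))"
proof -
  have "0 \<le> (D - y * \<bar>u\<bar> / sqrt 2)\<^sup>2" by simp
  also have "\<dots> = D\<^sup>2 - sqrt 2 * y * D * \<bar>u\<bar> + y\<^sup>2 * u\<^sup>2 / 2"
    by (simp add: power2_diff power_divide power_mult_distrib) (simp add: field_simps)
  finally have "sqrt 2 * D * \<bar>u\<bar> * y \<le> D\<^sup>2 + y\<^sup>2 * u\<^sup>2 / 2" by (simp add: algebra_simps)
  hence "sqrt 2 * D * \<bar>u\<bar> \<le> (D\<^sup>2 + y\<^sup>2 * u\<^sup>2 / 2) / y" using y by (simp add: pos_le_divide_eq)
  also have "\<dots> = D\<^sup>2 / y + y / 2 * u\<^sup>2" using y by (simp add: field_simps power2_eq_square)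
  finally have 1: "sqrt 2 * D * \<bar>u\<bar> \<le> D\<^sup>2 / y + y / 2 * u\<^sup>2" .
  have "- ((y * a - k) * u) \<le> \<bar>y * a - k\<bar> * \<bar>u\<bar>" by (metis abs_ge_minus_self abs_mult)
  also have "\<dots> \<le> D * \<bar>u\<bar>" by (intro mult_right_mono D) auto
  finally have "sqrt 2 * - ((y * a - k) * u) \<le> sqrt 2 * (D * \<bar>u\<bar>)" by (intro mult_left_mono) auto
  with 1 have "sqrt 2 * - ((y * a - k) * u) \<le> D\<^sup>2 / y + y / 2 * u\<^sup>2" by simp
  hence "pi * (sqrt 2 * - ((y * a - k) * u)) \<le> pi * (D\<^sup>2 / y + y / 2 * u\<^sup>2)" by (intro mult_left_mono) auto
  thus ?thesis unfolding norm_chirp exp_add[symmetric] by (simp add: algebra_simps)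
qed

lemma norm_kern:
  "norm (kern s y k z) = norm (chirp y k z) * norm z powr (- s)"
  by (simp add: kern_def norm_divide norm_powr_real_powr' powr_minus_divide)

lemma norm_kern_le:
  assumes "y > 0" "\<bar>y * a - k\<bar> \<le> D" "0 < b" "b \<le> a" "s \<ge> 0"
  shows "norm (kern s y k (slant a u)) \<le> (b / 2) powr (- s) * exp (pi * D\<^sup>2 / y) * exp (- (pi * (y / 2) * u\<^sup>2))"
proof -
  have "b / 2 \<le> norm (slant a u)" using norm_slant_ge(1)[of a u] assms by auto
  hence "norm (slant a u) powr (- s) \<le> (b / 2) powr (- s)"
    using assms by (intro powr_mono2') auto
  hence "norm (chirp y k (slant a u)) * norm (slant a u) powr (- s)
      \<le> (exp (pi * D\<^sup>2 / y) * exp (- (pi * (y / 2) * u\<^sup>2))) * (b / 2) powr (- s)"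
    by (intro mult_mono norm_chirp_le assms) auto
  thus ?thesis by (simp add: norm_kern mult_ac)
qed

lemma kern_holomorphic: "kern s y k holomorphic_on - \<real>\<^sub>\<le>\<^sub>0"
  unfolding kern_def chirp_def by (intro holomorphic_intros) auto

lemma strip_subset_slit:
  assumes "0 < a1" shows "{z. a1 \<le> Re z - Im z \<and> Re z - Im z \<le> a2} \<subseteq> - \<real>\<^sub>\<le>\<^sub>0"
  using assms by (auto simp: complex_nonpos_Reals_iff)

lemma continuous_on_kern_slant: "a > 0 \<Longrightarrow> continuous_on A (\<lambda>u. kern s y k (slant a u))"
  by (rule continuous_on_compose2[OF holomorphic_on_imp_continuous_on[OF kern_holomorphic]])
     (auto intro!: continuous_intros simp: slant_notin_nonpos)

lemma kern_integrable:
  assumes "y > 0" "a > 0" "s \<ge> 0"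
  shows "integrable lborel (\<lambda>u. kern s y k (slant a u))"
  using norm_kern_le[of y a k "\<bar>y * a - k\<bar>" a s] assms
  by (intro integrable_gaussian_bound[OF continuous_on_kern_slant, of a "y / 2" s y k
            "(a / 2) powr (- s) * exp (pi * \<bar>y * a - k\<bar>\<^sup>2 / y)"]) auto

text \<open>Without the denominator there are no poles, and strips to the right of 0 avoid the
  branch cut of the power, so Cauchy's theorem moves the line freely.\<close>

lemma kern_line_shift:
  assumes y: "y > 0" and s: "s \<ge> 0" and a: "a1 > 0" "a2 > 0"
  shows "(LINT u|lborel. kern s y k (slant a1 u) * rho) = (LINT u|lborel. kern s y k (slant a2 u) * rho)"
proof -
  have *: "(LINT u|lborel. kern s y k (slant a1 u) * rho) = (LINT u|lborel. kern s y k (slant a2 u) * rho)"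
    if a: "0 < a1" "a1 < a2" for a1 a2
  proof (rule slant_line_shift[OF a(2)])
    show "kern s y k holomorphic_on {z. a1 \<le> Re z - Im z \<and> Re z - Im z \<le> a2}"
      using holomorphic_on_subset[OF kern_holomorphic strip_subset_slit[OF a(1)]] .
    show "norm (kern s y k (slant a u))
         \<le> ((a1 / 2) powr (- s) * exp (pi * (y * a2 + k)\<^sup>2 / y)) * exp (- ((pi * (y / 2)) * u\<^sup>2))"
      if "a1 \<le> a" "a \<le> a2" for a u
    proof (rule norm_kern_le)
      have "0 \<le> y * a" "y * a \<le> y * a2" using y a that by auto
      thus "\<bar>y * a - k\<bar> \<le> y * a2 + k" by auto
    qed (use that a y s in auto)
  qed (use a y s in \<open>auto intro!: kern_integrable\<close>)
  show ?thesis using *[of a1 a2] *[of a2 a1] a by (cases a1 a2 rule: linorder_cases) auto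
qed

section \<open>Bounds for the denominator and the integrand\<close>

text \<open>For \<open>|v| \<ge> 1\<close> the moduli 1 and \<open>exp (- v)\<close> are far enough
  apart for the triangle inequality, because \<open>exp (- 1) \<le> 1 - exp (- 1)\<close>. For
  \<open>|v| \<le> 1\<close> the angle \<open>v\<close> stays below \<open>pi / 2\<close>, so the
  real part is at least 1.\<close>

lemma norm_one_plus_exp_diagonal:
  "exp (- 1) * max 1 (exp (- v)) \<le> norm (1 + exp (Complex (- v) v))"
proof -
  have ne: "norm (exp (Complex (- v) v)) = exp (- v)" by simp
  have e1: "exp (- 1) \<le> 1 - exp (- (1::real))"
    using exp_ge_add_one_self[of "1::real"] by (simp add: exp_minus field_simps)
  consider "v \<ge> 1" | "v \<le> -1" | "-1 \<le> v" "v \<le> 1" by linarith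
  thus ?thesis
  proof cases
    case 1
    hence ev: "exp (- v) \<le> exp (- 1)" by simp
    moreover have "norm (1::complex) - norm (exp (Complex (- v) v)) \<le> norm (1 + exp (Complex (- v) v))"
      by (rule norm_diff_ineq)
    moreover have "max 1 (exp (- v)) = 1" using 1 by simp
    ultimately show ?thesis using e1 ne ev by (simp del: exp_le_cancel_iff)
  next
    case 2
    have "norm (exp (Complex (- v) v)) - norm (1::complex) \<le> norm (exp (Complex (- v) v) + 1)"
      by (rule norm_diff_ineq)
    hence "exp (- v) - 1 \<le> norm (1 + exp (Complex (- v) v))" by (simp add: ne add.commute)
    moreover have "exp (- 1) * exp (- v) \<le> (1 - exp (- 1)) * exp (- v)" by (intro mult_right_mono e1) auto
    moreover have "exp 1 \<le> exp (- v)" using 2 by simp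
    hence "1 \<le> exp (- 1) * exp (- v)" by (simp flip: exp_add)
    moreover have m: "max 1 (exp (- v)) = exp (- v)" using 2 by simp
    moreover have "(1 - exp (- 1)) * exp (- v) = exp (- v) - exp (- 1) * exp (- v)"
      by (simp add: left_diff_distrib)
    ultimately show ?thesis unfolding m by linarith
  next
    case 3
    have "cos v \<ge> 0" using 3 pi_gt3 by (intro cos_ge_zero) auto
    hence "1 \<le> Re (1 + exp (Complex (- v) v))" by (simp add: Re_exp)
    also have "\<dots> \<le> norm (1 + exp (Complex (- v) v))" by (rule complex_Re_le_cmod)
    finally have "1 \<le> norm (1 + exp (Complex (- v) v))" .
    moreover have "exp (- 1) * max 1 (exp (- v)) \<le> exp (- 1) * exp 1"
      using 3 by (intro mult_left_mono) auto
    ultimately show ?thesis by (simp flip: exp_add)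
  qed
qed

text \<open>In \<open>q\<close> the half contributes the factor -1 and the integer \<open>m\<close>
  contributes 1, so \<open>den\<close> becomes \<open>1 + exp (- v + i v)\<close> with
  \<open>v = sqrt 2 * pi * u\<close>.\<close>

lemma norm_den_half_integer_line:
  "exp (- 1) * max 1 (exp (- (sqrt 2 * pi * u))) \<le> norm (den (slant (real m + 1 / 2) u))"
proof -
  have "2 * \<i> * of_real pi * slant (real m + 1 / 2) u =
     Complex (- (sqrt 2 * pi * u)) (sqrt 2 * pi * u) + \<i> * of_real pi + of_nat m * (2 * of_real pi * \<i>)"
    by (simp add: complex_eq_iff algebra_simps)
  hence "exp (2 * \<i> * of_real pi * slant (real m + 1 / 2) u)
     = - exp (Complex (- (sqrt 2 * pi * u)) (sqrt 2 * pi * u))"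
    by (simp only: exp_add exp_pi_i' exp_of_nat_mult exp_two_pi_i power_one) simp
  thus ?thesis using norm_one_plus_exp_diagonal[of "sqrt 2 * pi * u"] by (simp add: den_def)
qed

text \<open>Here \<open>q\<close> has modulus at most \<open>exp (- 2 pi)\<close> or at least
  \<open>exp (2 pi)\<close>. This controls the integrand far out on all lines between two
  half-integers.\<close>

lemma norm_den_far:
  assumes "\<bar>Im z\<bar> \<ge> 1" shows "norm (den z) \<ge> 1 / 2"
proof -
  have ne: "norm (exp (2 * \<i> * of_real pi * z)) = exp (- (2 * pi * Im z))" by simp
  have e: "2 \<le> exp (2 * pi)" using exp_ge_add_one_self[of "2 * pi"] pi_gt3 by linarith
  show ?thesis
  proof (cases "Im z \<ge> 1")
    case True
    hence "exp (- (2 * pi * Im z)) \<le> exp (- (2 * pi))" by simp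
    also have "\<dots> \<le> 1 / 2" using e by (simp add: exp_minus field_simps)
    finally have "exp (- (2 * pi * Im z)) \<le> 1 / 2" .
    moreover have "norm (1::complex) - norm (exp (2 * \<i> * of_real pi * z)) \<le> norm (den z)"
      unfolding den_def by (rule norm_triangle_ineq2)
    ultimately show ?thesis using ne by simp
  next
    case False
    hence "Im z \<le> -1" using assms by linarith
    hence "2 * pi * 1 \<le> 2 * pi * (- Im z)" by (intro mult_left_mono) auto
    hence "exp (2 * pi) \<le> exp (- (2 * pi * Im z))" by simp
    moreover have "norm (exp (2 * \<i> * of_real pi * z)) - norm (1::complex) \<le> norm (den z)"
      unfolding den_def by (metis norm_minus_commute norm_triangle_ineq2)
    ultimately show ?thesis using ne e by (simp del: exp_le_cancel_iff)
  qed
qed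

lemma den_eq_0_iff: "den z = 0 \<longleftrightarrow> z \<in> \<int>"
proof -
  have "den z = 0 \<longleftrightarrow> (\<exists>n::int. Im z = 0 \<and> Re z = n)"
    by (auto simp: den_def exp_eq_1)
  also have "\<dots> \<longleftrightarrow> z \<in> \<int>"
    by (auto simp: Ints_def complex_eq_iff image_iff)
  finally show ?thesis .
qed

text \<open>For \<open>u \<ge> 0\<close> the linear exponent only helps, as
  \<open>y * (m + 1 / 2) \<ge> K\<close>. For \<open>u < 0\<close> the growth of \<open>den\<close>
  effectively replaces \<open>K\<close> by \<open>K + 1\<close>, and
  \<open>y * m \<le> K + 1\<close> leaves an excess of at most \<open>y / 2\<close>, absorbed by
  half of the Gaussian at the cost of \<open>exp (pi / 4)\<close>. The factor \<open>exp 1\<close>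
  comes from the lower bound for \<open>den\<close>.\<close>

lemma half_integer_line_bound:
  assumes y: "0 < y" "y \<le> 1" and K: "real K \<le> y * m" "y * m \<le> real K + 1" and s: "s \<ge> 0"
  shows "norm (kern s y K (slant (real m + 1 / 2) u) / den (slant (real m + 1 / 2) u))
         \<le> exp (1 + pi / 4) * (norm (slant (real m + 1 / 2) u) powr (- s) * exp (- (pi * (y / 2) * u\<^sup>2)))"
proof -
  let ?z = "slant (real m + 1 / 2) u"
  define w where "w = exp (- (sqrt 2 * pi * u))"
  have "norm (chirp y K ?z) \<le> exp (pi / 4) * exp (- (pi * (y / 2) * u\<^sup>2)) * max 1 w"
  proof (cases "u \<ge> 0")
    case True
    have "0 \<le> sqrt 2 * pi * (y * (real m + 1 / 2) - K) * u"
      using True K y by (intro mult_nonneg_nonneg) (auto simp: algebra_simps)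
    hence "- (pi * y * u\<^sup>2) - sqrt 2 * pi * (y * (real m + 1 / 2) - K) * u \<le> - (pi * (y / 2) * u\<^sup>2)"
    proof -
      have "0 \<le> pi * (y / 2) * u\<^sup>2" using y by simp
      moreover have "pi * y * u\<^sup>2 = 2 * (pi * (y / 2) * u\<^sup>2)" by simp
      ultimately show ?thesis using \<open>0 \<le> sqrt 2 * pi * _ * u\<close> by linarith
    qed
    hence "norm (chirp y K ?z) \<le> exp (- (pi * (y / 2) * u\<^sup>2))" unfolding norm_chirp by simp
    also have "\<dots> = 1 * exp (- (pi * (y / 2) * u\<^sup>2)) * 1" by simp
    also have "\<dots> \<le> exp (pi / 4) * exp (- (pi * (y / 2) * u\<^sup>2)) * max 1 w"
      by (intro mult_mono) auto
    finally show ?thesis .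
  next
    case False
    hence w: "max 1 w = w" by (simp add: w_def mult_nonneg_nonpos)
    have "(y * (real m + 1 / 2) - K - 1) * (- u) \<le> y / 2 * (- u)"
      using False K by (intro mult_right_mono) (auto simp: algebra_simps)
    hence "sqrt 2 * ((y * (real m + 1 / 2) - K - 1) * (- u)) \<le> sqrt 2 * (y / 2 * (- u))"
      by (intro mult_left_mono) auto
    \<comment> \<open>Completing the square leaves the constant \<open>y / 4\<close>, and
      \<open>y \<le> 1\<close>.\<close>
    also have "sqrt 2 * (y / 2 * (- u)) \<le> y / 2 * u\<^sup>2 + 1 / 4"
    proof -
      have "0 \<le> (u + sqrt 2 / 2)\<^sup>2" by simp
      hence "- (sqrt 2 * u) \<le> u\<^sup>2 + 1 / 2" by (simp add: power2_sum power_divide mult.commute)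
      hence "y / 2 * - (sqrt 2 * u) \<le> y / 2 * (u\<^sup>2 + 1 / 2)" using y by (intro mult_left_mono) auto
      thus ?thesis using y by (simp add: algebra_simps)
    qed
    finally have "pi * (sqrt 2 * ((y * (real m + 1 / 2) - K - 1) * (- u))) \<le> pi * (y / 2 * u\<^sup>2 + 1 / 4)"
      by (intro mult_left_mono) auto
    hence "- (pi * y * u\<^sup>2) - sqrt 2 * pi * (y * (real m + 1 / 2) - K) * u
        \<le> pi / 4 + - (pi * (y / 2) * u\<^sup>2) + - (sqrt 2 * pi * u)"
      by (simp add: algebra_simps)
    thus ?thesis unfolding w unfolding w_def norm_chirp exp_add[symmetric] by simp
  qed
  moreover have mpos: "max 1 w > 0" by simp
  have "max 1 w / norm (den ?z) \<le> exp 1"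
  proof -
    have d: "exp (- 1) * max 1 w \<le> norm (den ?z)"
      using norm_den_half_integer_line[of u m] by (simp add: w_def)
    moreover have "0 < exp (- 1) * max 1 w" using mpos by simp
    ultimately have "norm (den ?z) > 0" by linarith
    thus ?thesis using d by (simp add: exp_minus field_simps)
  qed
  ultimately have "norm (chirp y K ?z) * (1 / norm (den ?z)) \<le> (exp (pi / 4) * exp (- (pi * (y / 2) * u\<^sup>2))) * (max 1 w / norm (den ?z))"
    by (simp add: divide_right_mono)
  also have "\<dots> \<le> (exp (pi / 4) * exp (- (pi * (y / 2) * u\<^sup>2))) * exp 1"
    by (intro mult_left_mono) (use \<open>max 1 w / norm (den ?z) \<le> exp 1\<close> in auto)
  finally have "norm (chirp y K ?z) * (1 / norm (den ?z)) * norm ?z powr (- s)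
      \<le> (exp (pi / 4) * exp (- (pi * (y / 2) * u\<^sup>2))) * exp 1 * norm ?z powr (- s)"
    by (rule mult_right_mono) simp
  thus ?thesis by (simp add: norm_divide norm_kern exp_add mult_ac)
qed

lemma den_half_integer_nonzero: "den (slant (real m + 1 / 2) u) \<noteq> 0"
  using norm_den_half_integer_line[of u m]
  by (smt (verit) exp_gt_zero mult_pos_pos norm_zero)

lemma continuous_on_half_integer_line:
  "continuous_on A (\<lambda>u. kern s y K (slant (real m + 1 / 2) u) / den (slant (real m + 1 / 2) u))"
proof (intro continuous_on_divide continuous_on_kern_slant)
  show "continuous_on A (\<lambda>u. den (slant (real m + 1 / 2) u))"
    unfolding den_def by (intro continuous_intros)
qed (auto simp: den_half_integer_nonzero)

lemma half_integer_line_integrable: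
  assumes y: "0 < y" and s: "s \<ge> 0"
  shows "integrable lborel (\<lambda>u. kern s y K (slant (real m + 1 / 2) u) / den (slant (real m + 1 / 2) u))"
proof (rule Bochner_Integration.integrable_bound)
  show "integrable lborel (\<lambda>u. of_real (exp 1) * kern s y K (slant (real m + 1 / 2) u))"
    using assms by (intro integrable_mult_right kern_integrable) auto
  show "(\<lambda>u. kern s y K (slant (real m + 1 / 2) u) / den (slant (real m + 1 / 2) u)) \<in> borel_measurable lborel"
    using borel_measurable_continuous_onI[OF continuous_on_half_integer_line[of UNIV]] by simp
  show "AE u in lborel. norm (kern s y K (slant (real m + 1 / 2) u) / den (slant (real m + 1 / 2) u))
     \<le> norm (of_real (exp 1) * kern s y K (slant (real m + 1 / 2) u))"
  proof (intro AE_I2)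
    fix u :: real
    let ?z = "slant (real m + 1 / 2) u"
    have "exp (- 1) * 1 \<le> exp (- 1) * max 1 (exp (- (sqrt 2 * pi * u)))"
      by (intro mult_left_mono) auto
    also have "\<dots> \<le> norm (den ?z)" by (rule norm_den_half_integer_line)
    finally have "norm (kern s y K ?z) / norm (den ?z) \<le> norm (kern s y K ?z) / exp (- 1)"
      by (intro divide_left_mono) (auto simp: den_half_integer_nonzero)
    thus "norm (kern s y K ?z / den ?z) \<le> norm (of_real (exp 1) * kern s y K ?z)"
      by (simp add: norm_divide norm_mult exp_minus field_simps)
  qed
qed

section \<open>Residues at the positive integers\<close>

text \<open>With \<open>K = 0\<close> this is the integral of \<open>f\<close> over the line through
  \<open>m + 1 / 2\<close>; with larger \<open>K\<close> it is the remainder of the geometric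
  expansion after \<open>K\<close> terms.\<close>

definition tail_int :: "real \<Rightarrow> real \<Rightarrow> nat \<Rightarrow> nat \<Rightarrow> complex" where
  "tail_int s y m K =
     (LINT u|lborel. kern s y K (slant (real m + 1 / 2) u) / den (slant (real m + 1 / 2) u) * rho)"

text \<open>\<open>den\<close> with its simple zero at \<open>k\<close> divided out; the value at
  \<open>k\<close> is the derivative there. Then \<open>f z = h z / (z - k)\<close> with
  \<open>h = kern / den_quot\<close>, the form of the residue lemma.\<close>

definition den_quot :: "nat \<Rightarrow> complex \<Rightarrow> complex" where
  "den_quot k z = (if z = of_nat k then - (2 * \<i> * of_real pi) else den z / (z - of_nat k))"

lemma den_of_nat [simp]: "den (of_nat k) = 0"
  by (simp add: den_eq_0_iff)

lemma den_quot_holomorphic: "den_quot k holomorphic_on UNIV"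
proof -
  have d: "deriv den (of_nat k) = - (2 * \<i> * of_real pi)"
  proof (rule DERIV_imp_deriv)
    have "exp (2 * \<i> * of_real pi * of_nat k) = 1"
      using den_of_nat[of k] by (simp add: den_def)
    moreover have "(den has_field_derivative - (exp (2 * \<i> * of_real pi * of_nat k) * (2 * \<i> * of_real pi))) (at (of_nat k))"
      unfolding den_def[abs_def] by (auto intro!: derivative_eq_intros)
    ultimately show "(den has_field_derivative - (2 * \<i> * of_real pi)) (at (of_nat k))" by simp
  qed
  have "(\<lambda>z. if z = of_nat k then deriv den (of_nat k) else (den z - den (of_nat k)) / (z - of_nat k)) holomorphic_on UNIV"
    by (rule pole_lemma) (auto simp: den_def[abs_def] intro!: holomorphic_intros)
  thus ?thesis unfolding d den_of_nat diff_0_right den_quot_def[abs_def] .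
qed

text \<open>The strip contains no integer other than \<open>k\<close>, and at \<open>k\<close> the
  zero of \<open>den\<close> is simple.\<close>

lemma den_quot_nonzero:
  assumes "real k - 1 / 2 \<le> Re z - Im z" "Re z - Im z \<le> real k + 1 / 2"
  shows "den_quot k z \<noteq> 0"
proof (cases "z = of_nat k")
  case False
  have "z \<notin> \<int>"
  proof
    assume "z \<in> \<int>"
    then obtain n where n: "z = of_int n" by (auto elim: Ints_cases)
    hence "real k - 1 / 2 \<le> real_of_int n" "real_of_int n \<le> real k + 1 / 2" using assms by auto
    hence "n = int k" by linarith
    with n False show False by simp
  qed
  thus ?thesis using False by (simp add: den_quot_def den_eq_0_iff)
qed (simp add: den_quot_def)

lemma kern_of_nat:
  assumes "k > 0"
  shows "kern s y 0 (of_nat k) = F_term s y k"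
proof -
  have "(of_nat k :: complex) powr of_real s = of_real (real k powr s)"
    using powr_of_real[of "real k" s] by simp
  thus ?thesis
    by (simp add: kern_def chirp_def F_term_def mult_ac)
qed

text \<open>The only pole of \<open>f\<close> between the two lines is \<open>k = m + 1\<close>.
  There \<open>den_quot\<close> is \<open>- 2 pi i\<close>, which cancels the \<open>2 pi i\<close>
  of the residue formula up to sign.\<close>

lemma tail_int_residue:
  assumes y: "0 < y" and s: "s \<ge> 0"
  shows "tail_int s y m 0 - tail_int s y (Suc m) 0 = F_term s y (Suc m)"
proof -
  define k where "k = Suc m"
  define h where "h z = kern s y 0 z / den_quot k z" for z
  have q: "h z / (z - of_real (real k)) = kern s y 0 z / den z" if "z \<noteq> of_nat k" for z
    using that by (simp add: h_def den_quot_def)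
  have nk: "slant a u \<noteq> of_nat k" if "a \<noteq> real k" for a u
    using that by (auto simp: complex_eq_iff)
  have l1: "real k - 1 / 2 = real m + 1 / 2" and l2: "real k + 1 / 2 = real (Suc m) + 1 / 2"
    by (auto simp: k_def)
  have n1: "slant (real k - 1 / 2) u \<noteq> of_nat k" and n2: "slant (real k + 1 / 2) u \<noteq> of_nat k" for u
    using nk[of "real k - 1 / 2" u] nk[of "real k + 1 / 2" u] by simp_all
  have "(LINT u|lborel. h (slant (real k + 1 / 2) u) / (slant (real k + 1 / 2) u - of_real (real k)) * rho)
      - (LINT u|lborel. h (slant (real k - 1 / 2) u) / (slant (real k - 1 / 2) u - of_real (real k)) * rho)
      = 2 * of_real pi * \<i> * h (of_real (real k))"
  \<comment> \<open>For \<open>|u| \<ge> 2\<close> the imaginary part has modulus at least 1, so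
    \<open>norm_den_far\<close> applies and gives the factor 2 in the bound below.\<close>
  proof (rule slant_line_residue[where U = 2])
    let ?S = "{z. real k - 1 / 2 \<le> Re z - Im z \<and> Re z - Im z \<le> real k + 1 / 2}"
    show "h holomorphic_on ?S"
      unfolding h_def
    proof (rule holomorphic_on_divide)
      show "kern s y 0 holomorphic_on ?S"
        by (rule holomorphic_on_subset[OF kern_holomorphic strip_subset_slit]) (simp add: k_def)
    qed (use den_quot_nonzero in \<open>auto intro: holomorphic_on_subset[OF den_quot_holomorphic]\<close>)
    show "integrable lborel (\<lambda>u. h (slant (real k - 1 / 2) u) / (slant (real k - 1 / 2) u - of_real (real k)))"
      unfolding q[OF n1] unfolding l1 by (rule half_integer_line_integrable[OF y s])
    show "integrable lborel (\<lambda>u. h (slant (real k + 1 / 2) u) / (slant (real k + 1 / 2) u - of_real (real k)))"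
      unfolding q[OF n2] unfolding l2 by (rule half_integer_line_integrable[OF y s])
    show "norm (h (slant a u) / (slant a u - of_real (real k)))
        \<le> (2 * ((1 / 2 / 2) powr (- s) * exp (pi * (y * (real k + 1 / 2))\<^sup>2 / y))) * exp (- ((pi * (y / 2)) * u\<^sup>2))"
      if a: "real k - 1 / 2 \<le> a" "a \<le> real k + 1 / 2" and u: "2 \<le> \<bar>u\<bar>" for a u
    proof -
      have a0: "1 / 2 \<le> a" using a by (simp add: k_def)
      have "1 * 2 \<le> sqrt 2 * \<bar>u\<bar>" using u by (intro mult_mono) auto
      hence im: "1 \<le> \<bar>Im (slant a u)\<bar>" by (simp add: abs_mult)
      have z: "slant a u \<noteq> of_nat k"
      proof
        assume "slant a u = of_nat k"
        hence "Im (slant a u) = 0" by simp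
        with im show False by linarith
      qed
      have "norm (kern s y 0 (slant a u) / den (slant a u)) \<le> norm (kern s y 0 (slant a u)) / (1 / 2)"
        unfolding norm_divide using norm_den_far[OF im] by (intro divide_left_mono) auto
      also have "\<dots> = 2 * norm (kern s y 0 (slant a u))" by simp
      also have "norm (kern s y 0 (slant a u)) \<le> (1 / 2 / 2) powr (- s)
          * exp (pi * (y * (real k + 1 / 2))\<^sup>2 / y) * exp (- (pi * (y / 2) * u\<^sup>2))"
      proof (rule norm_kern_le)
        have "0 \<le> y * a" "y * a \<le> y * (real k + 1 / 2)" using y a a0 by auto
        thus "\<bar>y * a - real 0\<bar> \<le> y * (real k + 1 / 2)" by simp
      qed (use y s a0 in auto)
      finally show ?thesis unfolding q[OF z] by (simp add: mult.assoc)
    qed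
  qed (use y in auto)
  hence "tail_int s y (Suc m) 0 - tail_int s y m 0 = 2 * of_real pi * \<i> * h (of_nat k)"
    unfolding q[OF n1] q[OF n2] unfolding tail_int_def l1 l2 by simp
  also have "\<dots> = - F_term s y k"
    using kern_of_nat[of k s y] by (simp add: h_def den_quot_def k_def)
  finally show ?thesis by (simp add: k_def algebra_simps)
qed

definition psum :: "real \<Rightarrow> real \<Rightarrow> nat \<Rightarrow> complex" where
  "psum s y n = (\<Sum>k<n. F_term s y (Suc k))"

lemma psum_eq_tail_int:
  assumes "0 < y" "s \<ge> 0"
  shows "psum s y n = tail_int s y 0 0 - tail_int s y n 0"
  unfolding psum_def by (induction n) (auto simp: tail_int_residue[OF assms, symmetric])

section \<open>Geometric expansion of the denominator\<close>

lemma kern_Suc: "kern s y k z = kern s y (Suc k) z * exp (2 * \<i> * of_real pi * z)"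
  by (simp add: kern_def chirp_def algebra_simps flip: exp_add)

text \<open>One factor \<open>q\<close> is extracted from the kernel, and then
  \<open>q / (1 - q) = 1 / (1 - q) - 1\<close>.\<close>

lemma tail_int_Suc:
  assumes y: "0 < y" and s: "s \<ge> 0"
  shows "tail_int s y m K = tail_int s y m (Suc K)
           - (LINT u|lborel. kern s y (Suc K) (slant (real m + 1 / 2) u) * rho)"
proof -
  let ?z = "slant (real m + 1 / 2)"
  have "kern s y K (?z u) / den (?z u) * rho =
     kern s y (Suc K) (?z u) / den (?z u) * rho - kern s y (Suc K) (?z u) * rho" for u
    unfolding kern_Suc[of s y K] using den_half_integer_nonzero[of m u]
    by (simp add: field_simps den_def)
  moreover have "integrable lborel (\<lambda>u. kern s y (Suc K) (?z u) / den (?z u) * rho)"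
    by (intro integrable_mult_left half_integer_line_integrable assms)
  moreover have "integrable lborel (\<lambda>u. kern s y (Suc K) (?z u) * rho)"
    using assms by (intro integrable_mult_left kern_integrable) auto
  ultimately show ?thesis unfolding tail_int_def
    by (simp only: Bochner_Integration.integral_diff)
qed

text \<open>Each term split off is free of poles, so it may be put on a line of its own; the base
  points \<open>a k\<close> will be the saddle points.\<close>

lemma tail_int_expand:
  assumes "0 < y" "s \<ge> 0" "\<And>k. a k > 0"
  shows "tail_int s y m 0 = tail_int s y m K
           - (\<Sum>k<K. LINT u|lborel. kern s y (Suc k) (slant (a k) u) * rho)"
proof (induction K)
  case (Suc K)
  thus ?case
    using tail_int_Suc[OF assms(1,2), of m K] kern_line_shift[OF assms(1,2), of "real m + 1 / 2" "a K" "Suc K"] assms(3)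
    by (simp add: algebra_simps)
qed simp

section \<open>Terms at their saddle points\<close>

text \<open>The bracket in the series of \<open>I\<close> at \<open>t = 0\<close>, as
  \<open>slant k (y * u)\<close> is \<open>k + rho * y * u\<close>.\<close>

definition power_diff :: "real \<Rightarrow> real \<Rightarrow> nat \<Rightarrow> real \<Rightarrow> complex" where
  "power_diff s y k u = 1 / slant (real k) (y * u) powr of_real s - 1 / of_real (real k powr s)"

lemma of_real_times_powr:
  fixes z :: complex and r s :: real
  assumes "r > 0" "z \<noteq> 0"
  shows "(of_real r * z) powr of_real s = of_real (r powr s) * z powr of_real s"
proof -
  have "exp (of_real s * (of_real (ln r) + Ln z)) = of_real (exp (s * ln r)) * exp (of_real s * Ln z)"
    by (simp add: ring_distribs exp_add exp_of_real flip: of_real_mult)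
  thus ?thesis using assms by (simp add: powr_def Ln_times_of_real Ln_of_real)
qed

text \<open>Completing the square at \<open>k / y\<close>, with \<open>rho^2 = i\<close>, leaves a
  pure Gaussian times the value of the chirp at the saddle. The factor \<open>y powr s\<close> comes
  from \<open>slant (k / y) u = slant k (y * u) / y\<close>.\<close>

lemma kern_stationary_line:
  assumes y: "y > 0" and k: "k > 0"
  shows "kern s y k (slant (real k / y) u) =
    exp (- \<i> * of_real (pi * (real k)\<^sup>2 / y)) * of_real (y powr s) *
      of_real (exp (- pi * y * u\<^sup>2)) * (1 / slant (real k) (y * u) powr of_real s)"
proof -
  have sl: "slant (real k / y) u = of_real (1 / y) * slant (real k) (y * u)"
    using y by (simp add: slant_def field_simps)
  have p: "slant (real k / y) u powr of_real s = of_real (y powr (- s)) * slant (real k) (y * u) powr of_real s"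
    unfolding sl using y k by (subst of_real_times_powr) (auto simp: slant_nonzero powr_divide powr_minus_divide)
  have r2: "rho\<^sup>2 = \<i>" by (simp add: rho_eq power2_eq_square complex_eq_iff)
  have "\<i> * of_real pi * (slant (real k / y) u)\<^sup>2 * of_real y - 2 * \<i> * of_real pi * of_nat k * slant (real k / y) u
     = - \<i> * of_real (pi * (real k)\<^sup>2 / y) + \<i> * of_real pi * rho\<^sup>2 * of_real y * of_real u ^ 2"
    using y by (simp add: slant_def power2_eq_square field_simps)
  also have "\<i> * of_real pi * rho\<^sup>2 * of_real y * of_real u ^ 2 = of_real (- pi * y * u\<^sup>2)"
    unfolding r2 by (simp add: complex_eq_iff flip: of_real_power)
  finally have c: "chirp y k (slant (real k / y) u) = exp (- \<i> * of_real (pi * (real k)\<^sup>2 / y)) * of_real (exp (- pi * y * u\<^sup>2))"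
    unfolding chirp_def by (simp only: exp_add exp_of_real)
  show ?thesis unfolding kern_def c p using y
    by (simp add: powr_minus field_simps)
qed

text \<open>Mean value estimate for \<open>z powr (- s)\<close> between
  \<open>k + rho * y * u\<close> and \<open>k\<close>. The segment stays on the slanted line through
  \<open>k\<close>, where \<open>norm z \<ge> k / 2\<close>, and 4 bounds
  \<open>2 powr (s + 1)\<close>. The gained power of \<open>k\<close> makes the series converge
  absolutely for \<open>s > 0\<close>.\<close>

lemma norm_power_diff_le:
  assumes k: "k > 0" and s: "0 \<le> s" "s \<le> 1" and y: "y > 0"
  shows "norm (power_diff s y k u) \<le> 4 * real k powr (- s - 1) * (y * \<bar>u\<bar>)"
proof -
  let ?S = "closed_segment (slant (real k) (y * u)) (slant (real k) 0)"
  let ?f = "\<lambda>z::complex. z powr (- of_real s)"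
  have onS: "\<exists>v. z = slant (real k) v" if "z \<in> ?S" for z
  proof -
    from that obtain t where "z = (1 - t) *\<^sub>R slant (real k) (y * u) + t *\<^sub>R slant (real k) 0"
      by (auto simp: closed_segment_def)
    hence "z = slant (real k) ((1 - t) * (y * u))"
      by (simp add: slant_def scaleR_conv_of_real algebra_simps)
    thus ?thesis by blast
  qed
  have "norm (?f (slant (real k) (y * u)) - ?f (slant (real k) 0))
     \<le> (4 * real k powr (- s - 1)) * norm (slant (real k) (y * u) - slant (real k) 0)"
  proof (rule field_differentiable_bound[where S = ?S])
    fix z assume "z \<in> ?S"
    then obtain v where v: "z = slant (real k) v" using onS by blast
    have nz: "z \<notin> \<real>\<^sub>\<le>\<^sub>0" unfolding v using k by (intro slant_notin_nonpos) auto
    show "(?f has_field_derivative (- of_real s * z powr (- of_real s - 1))) (at z within ?S)"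
      using has_field_derivative_powr[OF nz, of "- of_real s"] by (rule has_field_derivative_at_within)
    have "norm (z powr (- of_real s - 1)) = norm z powr (- s - 1)"
      by (subst norm_powr_real_powr') auto
    also have "\<dots> \<le> (real k / 2) powr (- s - 1)"
      using norm_slant_ge(1)[of "real k" v] k s unfolding v by (intro powr_mono2') auto
    also have "\<dots> = real k powr (- s - 1) * 2 powr (s + 1)"
      using k by (simp add: powr_divide powr_minus powr_diff powr_add field_simps)
    also have "\<dots> \<le> real k powr (- s - 1) * 2 powr 2"
      using s by (intro mult_left_mono powr_mono) auto
    finally have "norm (z powr (- of_real s - 1)) \<le> 4 * real k powr (- s - 1)" by simp
    hence "\<bar>s\<bar> * norm (z powr (- of_real s - 1)) \<le> 1 * (4 * real k powr (- s - 1))"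
      using s by (intro mult_mono) auto
    thus "norm (- of_real s * z powr (- of_real s - 1)) \<le> 4 * real k powr (- s - 1)"
      by (simp add: norm_mult)
  qed auto
  moreover have "?f (slant (real k) (y * u)) = 1 / slant (real k) (y * u) powr of_real s"
    by (simp add: powr_minus divide_inverse)
  moreover have "?f (slant (real k) 0) = 1 / of_real (real k powr s)"
    using powr_of_real[of "real k" s] by (simp add: slant_def powr_minus divide_inverse)
  moreover have "norm (slant (real k) (y * u) - slant (real k) 0) = y * \<bar>u\<bar>"
    using y by (simp add: slant_def norm_mult abs_mult)
  ultimately show ?thesis by (simp add: power_diff_def)
qed

text \<open>Half of the Gaussian pays for
  \<open>sqrt y * |u| \<le> exp (pi / 2 * (y * u^2))\<close>. The leftover \<open>sqrt y\<close>
  cancels against the mass of the other half, so the integrated bound does not depend on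
  \<open>y\<close>.\<close>

lemma norm_gaussian_power_diff_le:
  assumes k: "k > 0" and s: "0 \<le> s" "s \<le> 1" and y: "y > 0"
  shows "norm (of_real (exp (- pi * y * u\<^sup>2)) * power_diff s y k u)
     \<le> 4 * real k powr (- s - 1) * sqrt y * exp (- (pi * (y / 2) * u\<^sup>2))"
proof -
  have "sqrt y * \<bar>u\<bar> \<le> 1 + (sqrt y * \<bar>u\<bar>)\<^sup>2"
    using zero_le_power2[of "sqrt y * \<bar>u\<bar> - 1"] zero_le_power2[of "sqrt y * \<bar>u\<bar>"]
    unfolding power2_diff one_power2 mult_1_right by linarith
  also have "(sqrt y * \<bar>u\<bar>)\<^sup>2 = y * u\<^sup>2" using y by (simp add: power_mult_distrib)
  also have "1 + y * u\<^sup>2 \<le> exp (y * u\<^sup>2)" by (rule exp_ge_add_one_self)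
  also have "1 * (y * u\<^sup>2) \<le> pi / 2 * (y * u\<^sup>2)"
    using y pi_gt3 by (intro mult_right_mono) auto
  hence "exp (y * u\<^sup>2) \<le> exp (pi / 2 * (y * u\<^sup>2))" by simp
  finally have "sqrt y * \<bar>u\<bar> \<le> exp (pi / 2 * (y * u\<^sup>2))" .
  hence "(sqrt y * exp (- pi * y * u\<^sup>2)) * (sqrt y * \<bar>u\<bar>) \<le> (sqrt y * exp (- pi * y * u\<^sup>2)) * exp (pi / 2 * (y * u\<^sup>2))"
    using y by (intro mult_left_mono) auto
  moreover have "(sqrt y * exp (- pi * y * u\<^sup>2)) * exp (pi / 2 * (y * u\<^sup>2)) = sqrt y * exp (- (pi * (y / 2) * u\<^sup>2))"
    by (simp flip: exp_add)
  moreover have "(sqrt y * exp (- pi * y * u\<^sup>2)) * (sqrt y * \<bar>u\<bar>) = exp (- pi * y * u\<^sup>2) * (y * \<bar>u\<bar>)"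
    using y by (simp add: field_simps)
  ultimately have *: "exp (- pi * y * u\<^sup>2) * (y * \<bar>u\<bar>) \<le> sqrt y * exp (- (pi * (y / 2) * u\<^sup>2))"
    by (simp only:)
  have "norm (of_real (exp (- pi * y * u\<^sup>2)) * power_diff s y k u)
      \<le> exp (- pi * y * u\<^sup>2) * (4 * real k powr (- s - 1) * (y * \<bar>u\<bar>))"
    unfolding norm_mult by (intro mult_mono norm_power_diff_le assms) auto
  also have "\<dots> = 4 * real k powr (- s - 1) * (exp (- pi * y * u\<^sup>2) * (y * \<bar>u\<bar>))" by simp
  also have "\<dots> \<le> 4 * real k powr (- s - 1) * (sqrt y * exp (- (pi * (y / 2) * u\<^sup>2)))"
    by (intro mult_left_mono *) auto
  finally show ?thesis by (simp add: mult.assoc)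
qed

subsection \<open>The approximate functional equation\<close>

definition power_diff_int :: "real \<Rightarrow> real \<Rightarrow> nat \<Rightarrow> complex" where
  "power_diff_int s y k = (LINT u|lborel. of_real (exp (- pi * y * u\<^sup>2)) * power_diff s y k u)"

lemma gaussian_half_integral:
  assumes "y > 0"
  shows "integrable lborel (\<lambda>u. exp (- (pi * (y / 2) * u\<^sup>2)))"
    and "(LINT u|lborel. exp (- (pi * (y / 2) * u\<^sup>2))) = sqrt 2 / sqrt y"
  using gaussian_integral[of "y / 2"] assms
  by (auto simp: has_bochner_integral_iff real_sqrt_divide)

lemma gaussian_power_diff_integrable:
  assumes k: "k > 0" and s: "0 \<le> s" "s \<le> 1" and y: "y > 0"
  shows "integrable lborel (\<lambda>u. of_real (exp (- pi * y * u\<^sup>2)) * power_diff s y k u)"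
proof (rule integrable_gaussian_bound)
  have "continuous_on UNIV (\<lambda>u. slant (real k) (y * u) powr of_real s)"
  proof (rule continuous_on_compose2[of "- \<real>\<^sub>\<le>\<^sub>0" "\<lambda>z. z powr of_real s"])
    show "continuous_on (- \<real>\<^sub>\<le>\<^sub>0) (\<lambda>z::complex. z powr of_real s)"
      by (intro holomorphic_on_imp_continuous_on holomorphic_intros) auto
    show "continuous_on UNIV (\<lambda>u. slant (real k) (y * u))"
      unfolding slant_def by (intro continuous_intros)
  qed (use k slant_notin_nonpos in auto)
  thus "continuous_on UNIV (\<lambda>u. of_real (exp (- pi * y * u\<^sup>2)) * power_diff s y k u)"
    unfolding power_diff_def using k slant_nonzero[of "real k"]
    by (intro continuous_on_mult continuous_on_diff continuous_on_divide continuous_on_const)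
       (auto intro!: continuous_intros)
  show "norm (of_real (exp (- pi * y * u\<^sup>2)) * power_diff s y k u)
     \<le> 4 * real k powr (- s - 1) * sqrt y * exp (- (pi * (y / 2) * u\<^sup>2))" for u
    by (rule norm_gaussian_power_diff_le[OF assms])
qed (use y in auto)

lemma integral_norm_gaussian_power_diff_le:
  assumes k: "k > 0" and s: "0 \<le> s" "s \<le> 1" and y: "y > 0"
  shows "(LINT u|lborel. norm (of_real (exp (- pi * y * u\<^sup>2)) * power_diff s y k u))
           \<le> 4 * sqrt 2 * real k powr (- s - 1)"
proof -
  have "(LINT u|lborel. norm (of_real (exp (- pi * y * u\<^sup>2)) * power_diff s y k u))
      \<le> (LINT u|lborel. 4 * real k powr (- s - 1) * sqrt y * exp (- (pi * (y / 2) * u\<^sup>2)))"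
    by (intro integral_mono integrable_norm gaussian_power_diff_integrable integrable_mult_right
         gaussian_half_integral norm_gaussian_power_diff_le assms)
  also have "\<dots> = 4 * sqrt 2 * real k powr (- s - 1)"
    unfolding integral_mult_right_zero gaussian_half_integral(2)[OF y] using y by simp
  finally show ?thesis .
qed

lemma norm_power_diff_int_le:
  assumes "k > 0" "0 \<le> s" "s \<le> 1" "y > 0"
  shows "norm (power_diff_int s y k) \<le> 4 * sqrt 2 * real k powr (- s - 1)"
  unfolding power_diff_int_def
  by (rule order_trans[OF integral_norm_bound integral_norm_gaussian_power_diff_le[OF assms]])

text \<open>Splitting the power into \<open>power_diff\<close> and \<open>k powr (- s)\<close>
  separates a term of the series in \<open>I\<close> from a full Gaussian integral. The latter is
  \<open>1 / sqrt y\<close>, and the phase at the saddle is that of \<open>F\<close> at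
  \<open>- 1 / y\<close>; this produces the dual sum.\<close>

lemma kern_line_integral:
  assumes k: "k > 0" and s: "0 \<le> s" "s \<le> 1" and y: "y > 0"
  shows "(LINT u|lborel. kern s y k (slant (real k / y) u) * rho) =
     rho * of_real (y powr s) * (exp (- \<i> * of_real (pi * (real k)\<^sup>2 / y)) * power_diff_int s y k)
     + rho * of_real (y powr (s - 1 / 2)) * F_term s (- 1 / y) k"
proof -
  define c where "c = rho * of_real (y powr s) * exp (- \<i> * of_real (pi * (real k)\<^sup>2 / y))"
  have eq: "kern s y k (slant (real k / y) u) * rho = c * (of_real (exp (- pi * y * u\<^sup>2)) * power_diff s y k u)
      + c / of_real (real k powr s) * of_real (exp (- (pi * y * u\<^sup>2)))" for u
    unfolding kern_stationary_line[OF y k] power_diff_def c_def by (simp add: algebra_simps)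
  have g: "has_bochner_integral lborel (\<lambda>u. complex_of_real (exp (- (pi * y * u\<^sup>2)))) (of_real (1 / sqrt y))"
    by (intro has_bochner_integral_of_real gaussian_integral y)
  have "(LINT u|lborel. kern s y k (slant (real k / y) u) * rho) =
     (LINT u|lborel. c * (of_real (exp (- pi * y * u\<^sup>2)) * power_diff s y k u))
      + (LINT u|lborel. c / of_real (real k powr s) * of_real (exp (- (pi * y * u\<^sup>2))))"
    unfolding eq using g
    by (intro Bochner_Integration.integral_add integrable_mult_right gaussian_power_diff_integrable assms)
       (auto simp: has_bochner_integral_iff)
  also have "\<dots> = c * power_diff_int s y k + c / of_real (real k powr s) * of_real (1 / sqrt y)"
    using g by (simp add: power_diff_int_def has_bochner_integral_iff)
  also have "c / of_real (real k powr s) * of_real (1 / sqrt y)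
      = rho * of_real (y powr (s - 1 / 2)) * F_term s (- 1 / y) k"
    using y by (simp add: c_def F_term_def powr_diff powr_half_sqrt mult_ac)
  finally show ?thesis by (simp add: c_def mult_ac)
qed

text \<open>An exact identity in which \<open>m\<close> and \<open>K\<close> vary independently;
  they are tied together only when \<open>tail_int\<close> is estimated. The term of index
  \<open>Suc k\<close> sits on the line through its saddle \<open>Suc k / y\<close>.\<close>

lemma psum_approx_functional_eq:
  assumes s: "0 \<le> s" "s \<le> 1" and y: "y > 0"
  shows "psum s y m - rho * of_real (y powr (s - 1 / 2)) * psum s (- 1 / y) K =
     tail_int s y 0 0 - tail_int s y m K
     + rho * of_real (y powr s) *
       (\<Sum>k<K. exp (- \<i> * of_real (pi * (real (Suc k))\<^sup>2 / y)) * power_diff_int s y (Suc k))"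
proof -
  have "tail_int s y m 0 = tail_int s y m K
           - (\<Sum>k<K. LINT u|lborel. kern s y (Suc k) (slant (real (Suc k) / y) u) * rho)"
    using y s by (intro tail_int_expand) auto
  also have "(\<Sum>k<K. LINT u|lborel. kern s y (Suc k) (slant (real (Suc k) / y) u) * rho)
     = rho * of_real (y powr s) * (\<Sum>k<K. exp (- \<i> * of_real (pi * (real (Suc k))\<^sup>2 / y)) * power_diff_int s y (Suc k))
      + rho * of_real (y powr (s - 1 / 2)) * psum s (- 1 / y) K"
    unfolding psum_def sum_distrib_left sum.distrib[symmetric]
    by (intro sum.cong refl kern_line_integral s y) simp
  finally show ?thesis using psum_eq_tail_int[OF y s(1), of m] by simp
qed

lemma summable_power_diff_bound:
  assumes "s > 0"
  shows "summable (\<lambda>k. 4 * sqrt 2 * real (Suc k) powr (- s - 1))"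
  using assms by (intro summable_mult summable_Suc_iff[THEN iffD2] iffD2[OF summable_real_powr_iff]) auto

text \<open>Sum and integral may be exchanged because the integrated norms are at most a multiple of
  \<open>k powr (- s - 1)\<close>, which is summable for \<open>s > 0\<close>.\<close>

lemma power_diff_int_sums:
  assumes s: "0 < s" "s \<le> 1" and y: "y > 0"
  shows "(\<lambda>k. exp (- \<i> * of_real (pi * (real (Suc k))\<^sup>2 / y)) * power_diff_int s y (Suc k))
           sums (LINT u|lborel. series_integrand s y 0 u)"
proof -
  define e where "e k = exp (- \<i> * of_real (pi * (real (Suc k))\<^sup>2 / y))" for k
  have ne: "norm (e k) = 1" for k by (simp add: e_def)
  define f where "f k u = e k * (of_real (exp (- pi * y * u\<^sup>2)) * power_diff s y (Suc k) u)" for k u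
  have s0: "0 \<le> s" using s by simp
  have sum_pd: "summable (\<lambda>k. norm (e k * power_diff s y (Suc k) u))" for u
  proof (rule summable_comparison_test')
    show "summable (\<lambda>k. (4 * sqrt 2 * real (Suc k) powr (- s - 1)) * (y * \<bar>u\<bar>))"
      by (intro summable_mult2 summable_power_diff_bound s)
    show "norm (norm (e k * power_diff s y (Suc k) u)) \<le> (4 * sqrt 2 * real (Suc k) powr (- s - 1)) * (y * \<bar>u\<bar>)" for k
    proof -
      have "norm (e k * power_diff s y (Suc k) u) \<le> 4 * real (Suc k) powr (- s - 1) * (y * \<bar>u\<bar>)"
        using norm_power_diff_le[OF _ s0 s(2) y, of "Suc k" u] by (simp add: norm_mult ne)
      also have "\<dots> \<le> (4 * sqrt 2 * real (Suc k) powr (- s - 1)) * (y * \<bar>u\<bar>)"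
        using y by (intro mult_right_mono) auto
      finally show ?thesis by simp
    qed
  qed
  have sf: "summable (\<lambda>k. norm (f k u))" for u
  proof -
    have "(\<lambda>k. norm (f k u)) = (\<lambda>k. exp (- pi * y * u\<^sup>2) * norm (e k * power_diff s y (Suc k) u))"
      by (simp add: f_def norm_mult mult_ac)
    thus ?thesis by (simp only: summable_mult[OF sum_pd])
  qed
  have eq: "series_integrand s y 0 u = (\<Sum>k. f k u)" for u
  proof -
    have "series_integrand s y 0 u = of_real (exp (- pi * y * u\<^sup>2)) * (\<Sum>k. e k * power_diff s y (Suc k) u)"
      by (simp add: series_integrand_def Let_def e_def power_diff_def slant_def add_ac)
    also have "\<dots> = (\<Sum>k. f k u)"
      unfolding f_def using suminf_mult[OF summable_norm_cancel[OF sum_pd], of "of_real (exp (- pi * y * u\<^sup>2))" u]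
      by (simp add: mult_ac)
    finally show ?thesis .
  qed
  have fint: "integrable lborel (f k)" for k
    unfolding f_def using s y by (intro integrable_mult_right gaussian_power_diff_integrable) auto
  have "(\<lambda>k. LINT u|lborel. f k u) sums (LINT u|lborel. (\<Sum>k. f k u))"
  proof (rule sums_integral[OF fint])
    show "AE u in lborel. summable (\<lambda>k. norm (f k u))" using sf by simp
    show "summable (\<lambda>k. LINT u|lborel. norm (f k u))"
    proof (rule summable_comparison_test'[OF summable_power_diff_bound[OF s(1)]])
      fix k
      have "(LINT u|lborel. norm (f k u)) = (LINT u|lborel. norm (of_real (exp (- pi * y * u\<^sup>2)) * power_diff s y (Suc k) u))"
        unfolding f_def norm_mult ne by simp
      also have "\<dots> \<le> 4 * sqrt 2 * real (Suc k) powr (- s - 1)"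
        by (rule integral_norm_gaussian_power_diff_le) (use s y in auto)
      finally show "norm (LINT u|lborel. norm (f k u)) \<le> 4 * sqrt 2 * real (Suc k) powr (- s - 1)"
        by (simp add: abs_of_nonneg)
    qed
  qed
  moreover have "(LINT u|lborel. f k u) = e k * power_diff_int s y (Suc k)" for k
    unfolding f_def power_diff_int_def by (rule integral_mult_right_zero)
  ultimately show ?thesis unfolding eq e_def by simp
qed

section \<open>Size of the remainder integral\<close>

text \<open>The majorant \<open>g\<close> is left open because two are used: one decaying in
  \<open>m\<close> for the limit, one independent of \<open>m\<close> for the uniform bound.\<close>

lemma norm_tail_int_le:
  assumes y: "0 < y" "y \<le> 1" and K: "real K \<le> y * m" "y * m \<le> real K + 1" and s: "s \<ge> 0"
    and g: "integrable lborel g"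
      "\<And>u. norm (slant (real m + 1 / 2) u) powr (- s) * exp (- (pi * (y / 2) * u\<^sup>2)) \<le> g u"
  shows "norm (tail_int s y m K) \<le> exp (1 + pi / 4) * (LINT u|lborel. g u)"
proof -
  have "norm (tail_int s y m K) \<le> (LINT u|lborel. exp (1 + pi / 4) * g u)"
    unfolding tail_int_def
  proof (rule Bochner_Integration.integral_norm_bound_integral)
    show "integrable lborel (\<lambda>u. kern s y K (slant (real m + 1 / 2) u) / den (slant (real m + 1 / 2) u) * rho)"
      by (intro integrable_mult_left half_integer_line_integrable y s)
    show "integrable lborel (\<lambda>u. exp (1 + pi / 4) * g u)" by (intro integrable_mult_right g)
    show "norm (kern s y K (slant (real m + 1 / 2) u) / den (slant (real m + 1 / 2) u) * rho)
            \<le> exp (1 + pi / 4) * g u" for u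
    proof -
      have "norm (kern s y K (slant (real m + 1 / 2) u) / den (slant (real m + 1 / 2) u) * rho)
         = norm (kern s y K (slant (real m + 1 / 2) u) / den (slant (real m + 1 / 2) u))"
        by (simp only: norm_mult norm_rho mult_1_right)
      also have "\<dots> \<le> exp (1 + pi / 4) * (norm (slant (real m + 1 / 2) u) powr (- s) * exp (- (pi * (y / 2) * u\<^sup>2)))"
        by (rule half_integer_line_bound[OF y K s])
      also have "\<dots> \<le> exp (1 + pi / 4) * g u" by (intro mult_left_mono g) auto
      finally show ?thesis .
    qed
  qed
  thus ?thesis by simp
qed

text \<open>On the line through \<open>m + 1 / 2\<close> one has
  \<open>norm z \<ge> (m + 1 / 2) / 2\<close>, so for fixed \<open>y\<close> the integral is at most
  of order \<open>m powr (- s)\<close>.\<close>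

lemma tail_int_tendsto_0:
  assumes y: "0 < y" "y \<le> 1" and s: "s > 0"
  shows "(\<lambda>m. tail_int s y m (nat \<lfloor>real m * y\<rfloor>)) \<longlonglongrightarrow> 0"
proof (rule Lim_null_comparison)
  show "eventually (\<lambda>m. norm (tail_int s y m (nat \<lfloor>real m * y\<rfloor>))
     \<le> exp (1 + pi / 4) * (((real m + 1 / 2) / 2) powr (- s) * (sqrt 2 / sqrt y))) sequentially"
  proof (intro always_eventually allI)
    fix m
    have K: "real (nat \<lfloor>real m * y\<rfloor>) \<le> y * m" "y * m \<le> real (nat \<lfloor>real m * y\<rfloor>) + 1"
      using y by (auto simp: mult.commute of_nat_nat intro: less_imp_le[OF real_of_int_floor_add_one_gt])
    have "norm (tail_int s y m (nat \<lfloor>real m * y\<rfloor>)) \<le> exp (1 + pi / 4) *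
       (LINT u|lborel. ((real m + 1 / 2) / 2) powr (- s) * exp (- (pi * (y / 2) * u\<^sup>2)))"
    proof (rule norm_tail_int_le[OF y K])
      show "norm (slant (real m + 1 / 2) u) powr (- s) * exp (- (pi * (y / 2) * u\<^sup>2))
         \<le> ((real m + 1 / 2) / 2) powr (- s) * exp (- (pi * (y / 2) * u\<^sup>2))" for u
        using norm_slant_ge(1)[of "real m + 1 / 2" u] s by (intro mult_right_mono powr_mono2') auto
    qed (use s y gaussian_half_integral(1) in auto)
    thus "norm (tail_int s y m (nat \<lfloor>real m * y\<rfloor>))
     \<le> exp (1 + pi / 4) * (((real m + 1 / 2) / 2) powr (- s) * (sqrt 2 / sqrt y))"
      unfolding integral_mult_right_zero gaussian_half_integral(2)[OF y(1)] .
  qed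
  have "((\<lambda>m. ((real m + 1 / 2) / 2) powr (- s)) \<longlonglongrightarrow> 0)"
    using s by real_asymp
  from tendsto_mult_right_zero[OF tendsto_mult_left_zero[OF this]]
  show "(\<lambda>m. exp (1 + pi / 4) * (((real m + 1 / 2) / 2) powr (- s) * (sqrt 2 / sqrt y))) \<longlonglongrightarrow> 0" .
qed

text \<open>The dual length grows with \<open>m\<close>, so the partial series fills up the second
  integral of \<open>I\<close> while the remainder vanishes; \<open>tail_int s y 0 0\<close> is the
  first integral.\<close>

lemma psum_approx_tendsto:
  assumes y: "0 < y" "y \<le> 1" and s: "0 < s" "s \<le> 1"
  shows "(\<lambda>m. psum s y m - rho * of_real (y powr (s - 1 / 2)) * psum s (- 1 / y) (nat \<lfloor>real m * y\<rfloor>))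
           \<longlonglongrightarrow> I s y 0"
proof -
  let ?K = "\<lambda>m. nat \<lfloor>real m * y\<rfloor>"
  have "filterlim ?K sequentially sequentially"
    using y by real_asymp
  from filterlim_compose[OF power_diff_int_sums[OF s y(1), unfolded sums_def] this]
  have "(\<lambda>m. tail_int s y 0 0 - tail_int s y m (?K m) + rho * of_real (y powr s) *
       (\<Sum>k<?K m. exp (- \<i> * of_real (pi * (real (Suc k))\<^sup>2 / y)) * power_diff_int s y (Suc k)))
     \<longlonglongrightarrow> tail_int s y 0 0 - 0 + rho * of_real (y powr s) * (LINT u|lborel. series_integrand s y 0 u)"
    by (intro tendsto_intros tail_int_tendsto_0 y s)
  moreover have "tail_int s y 0 0 = (LINT u|lborel. line_integrand s y 0 (1 / 2 + rho * of_real u) * rho)"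
    by (simp add: tail_int_def line_integrand_def kern_def den_def chirp_def slant_def)
  ultimately show ?thesis
    unfolding psum_approx_functional_eq[OF less_imp_le[OF s(1)] s(2) y(1)] I_def by simp
qed

text \<open>The Gaussian takes effect around \<open>|u| = Y\<close>. Up to there it is dropped and
  \<open>(1 + |u|) powr (- s)\<close> is integrated exactly; beyond, the power is frozen at
  \<open>Y powr (- s)\<close> and the Gaussian has mass \<open>sqrt 2 * Y\<close>. The
  antiderivative \<open>Q\<close> is a parameter so that \<open>s < 1\<close> and
  \<open>s = 1\<close> share the argument.\<close>

lemma tail_int_antiderivative_bound:
  assumes y: "0 < y" "y \<le> 1" and K: "real K \<le> y * m" "y * m \<le> real K + 1" and s: "0 \<le> s" "s \<le> 1"
    and Q: "\<And>x. x > 0 \<Longrightarrow> (Q has_real_derivative x powr (- s)) (at x)"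
  defines "Y \<equiv> 1 / sqrt y"
  shows "norm (tail_int s y m K) \<le> exp (1 + pi / 4) * (6 * (2 * (Q (1 + Y) - Q 1) + sqrt 2 * Y powr (1 - s)))"
proof -
  define E where "E u = exp (- (pi * (y / 2) * u\<^sup>2))" for u
  define f1 where "f1 u = indicator {0..Y} u *\<^sub>R (1 + u) powr (- s)" for u
  define f2 where "f2 u = indicator {- Y..0} u *\<^sub>R (1 - u) powr (- s)" for u
  define g where "g u = 6 * (f1 u + f2 u + Y powr (- s) * E u)" for u
  have Y: "Y > 0" using y by (simp add: Y_def)
  have i1: "has_bochner_integral lborel f1 (Q (1 + Y) - Q (1 + 0))"
    unfolding f1_def
  proof (rule has_bochner_integral_FTC_Icc)
    fix x :: real assume x: "0 \<le> x" "x \<le> Y"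
    have "((\<lambda>u. Q (1 + u)) has_real_derivative (1 + x) powr (- s) * 1) (at x)"
      by (rule DERIV_chain2[OF Q]) (use x in \<open>auto intro!: derivative_eq_intros\<close>)
    thus "((\<lambda>u. Q (1 + u)) has_vector_derivative (1 + x) powr (- s)) (at x within {0..Y})"
      by (simp add: has_real_derivative_iff_has_vector_derivative has_vector_derivative_at_within)
  qed (use Y in \<open>auto intro!: continuous_intros\<close>)
  have i2: "has_bochner_integral lborel f2 (- Q (1 - 0) - - Q (1 - (- Y)))"
    unfolding f2_def
  proof (rule has_bochner_integral_FTC_Icc)
    fix x :: real assume x: "- Y \<le> x" "x \<le> 0"
    have "((\<lambda>u. - Q (1 - u)) has_real_derivative - ((1 - x) powr (- s) * (- 1))) (at x)"
      by (intro DERIV_minus DERIV_chain2[OF Q]) (use x in \<open>auto intro!: derivative_eq_intros\<close>)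
    thus "((\<lambda>u. - Q (1 - u)) has_vector_derivative (1 - x) powr (- s)) (at x within {- Y..0})"
      by (simp add: has_real_derivative_iff_has_vector_derivative has_vector_derivative_at_within)
  qed (use Y in \<open>auto intro!: continuous_intros\<close>)
  have i3: "has_bochner_integral lborel E (sqrt 2 * Y)"
    unfolding E_def using gaussian_half_integral[OF y(1)] by (simp add: has_bochner_integral_iff Y_def)
  have "has_bochner_integral lborel g (6 * ((Q (1 + Y) - Q (1 + 0)) + (- Q (1 - 0) - - Q (1 - (- Y))) + Y powr (- s) * (sqrt 2 * Y)))"
    unfolding g_def by (intro has_bochner_integral_mult_right has_bochner_integral_add i1 i2 i3)
  moreover have "Y powr (- s) * (sqrt 2 * Y) = sqrt 2 * Y powr (1 - s)"
    using Y by (simp add: powr_diff powr_minus field_simps)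
  ultimately have g: "has_bochner_integral lborel g (6 * (2 * (Q (1 + Y) - Q 1) + sqrt 2 * Y powr (1 - s)))"
    by simp
  have E: "0 \<le> E u" "E u \<le> 1" for u using y by (auto simp: E_def)
  have f: "0 \<le> f1 u" "0 \<le> f2 u" for u by (auto simp: f1_def f2_def indicator_def)
  have gb: "norm (slant (real m + 1 / 2) u) powr (- s) * E u \<le> g u" for u
  proof -
    \<comment> \<open>\<open>4 * norm z \<ge> 1\<close> and \<open>2 * norm z \<ge> |u|\<close> add
      up to the constant 6.\<close>
    have "(1 + \<bar>u\<bar>) / 6 \<le> norm (slant (real m + 1 / 2) u)"
      using norm_slant_ge(1)[of "real m + 1 / 2" u] norm_slant_ge(2)[of u "real m + 1 / 2"] by (auto simp: field_simps)
    hence "norm (slant (real m + 1 / 2) u) powr (- s) \<le> ((1 + \<bar>u\<bar>) / 6) powr (- s)"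
      using s by (intro powr_mono2') auto
    also have "\<dots> = 6 powr s * (1 + \<bar>u\<bar>) powr (- s)"
      by (simp add: powr_divide powr_minus field_simps)
    also have "\<dots> \<le> 6 powr 1 * (1 + \<bar>u\<bar>) powr (- s)"
      using s by (intro mult_right_mono powr_mono) auto
    finally have "norm (slant (real m + 1 / 2) u) powr (- s) \<le> 6 * (1 + \<bar>u\<bar>) powr (- s)" by simp
    hence "norm (slant (real m + 1 / 2) u) powr (- s) * E u \<le> 6 * (1 + \<bar>u\<bar>) powr (- s) * E u"
      by (intro mult_right_mono E)
    also have "(1 + \<bar>u\<bar>) powr (- s) * E u \<le> f1 u + f2 u + Y powr (- s) * E u"
    proof (cases "\<bar>u\<bar> \<le> Y")
      case True
      have "(1 + \<bar>u\<bar>) powr (- s) * E u \<le> (1 + \<bar>u\<bar>) powr (- s) * 1"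
        by (intro mult_left_mono E) auto
      moreover have "(1 + \<bar>u\<bar>) powr (- s) = f1 u \<or> (1 + \<bar>u\<bar>) powr (- s) = f2 u"
        using True by (cases "u \<ge> 0") (auto simp: f1_def f2_def)
      moreover have "0 \<le> Y powr (- s) * E u" using E by simp
      ultimately show ?thesis using f[of u] by auto
    next
      case False
      hence "(1 + \<bar>u\<bar>) powr (- s) \<le> Y powr (- s)" using Y s by (intro powr_mono2') auto
      hence "(1 + \<bar>u\<bar>) powr (- s) * E u \<le> Y powr (- s) * E u" by (intro mult_right_mono E)
      thus ?thesis using f[of u] by linarith
    qed
    hence "6 * (1 + \<bar>u\<bar>) powr (- s) * E u \<le> g u" unfolding g_def by simp
    finally show ?thesis .
  qed
  have "norm (tail_int s y m K) \<le> exp (1 + pi / 4) * (LINT u|lborel. g u)"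
    using g gb by (intro norm_tail_int_le y K s) (auto simp: has_bochner_integral_iff E_def)
  thus ?thesis using g by (simp add: has_bochner_integral_iff)
qed

text \<open>With a power as antiderivative, both contributions are at most multiples of
  \<open>Y powr (1 - s)\<close>, the required power of \<open>y\<close>.\<close>

lemma tail_int_bound_less_1:
  assumes s: "0 < s" "s < 1"
  obtains C where "\<And>y m K. 0 < y \<Longrightarrow> y \<le> 1 \<Longrightarrow> real K \<le> y * real m \<Longrightarrow> y * real m \<le> real K + 1 \<Longrightarrow>
        norm (tail_int s y m K) \<le> C * (1 / y powr ((1 - s) / 2))"
proof (rule that)
  fix y :: real and m K :: nat
  assume y: "0 < y" "y \<le> 1" and K: "real K \<le> y * real m" "y * real m \<le> real K + 1"
  define Y where "Y = 1 / sqrt y"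
  define Q where "Q x = x powr (1 - s) / (1 - s)" for x :: real
  have Y: "Y \<ge> 1" using y by (simp add: Y_def)
  have Yp: "Y powr (1 - s) = 1 / y powr ((1 - s) / 2)"
    using y by (simp add: Y_def powr_divide powr_powr flip: powr_half_sqrt)
  have "(Q has_real_derivative x powr (- s)) (at x)" if "x > 0" for x
    unfolding Q_def using s that by (auto intro!: derivative_eq_intros)
  hence "norm (tail_int s y m K) \<le> exp (1 + pi / 4) * (6 * (2 * (Q (1 + Y) - Q 1) + sqrt 2 * Y powr (1 - s)))"
    unfolding Y_def using s by (intro tail_int_antiderivative_bound y K) auto
  also have "Q (1 + Y) - Q 1 \<le> 2 / (1 - s) * Y powr (1 - s)"
  proof -
    have "(1 + Y) powr (1 - s) \<le> (2 * Y) powr (1 - s)" using Y s by (intro powr_mono2) auto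
    also have "\<dots> = 2 powr (1 - s) * Y powr (1 - s)" using Y by (simp add: powr_mult)
    also have "\<dots> \<le> 2 powr 1 * Y powr (1 - s)" using s by (intro mult_right_mono powr_mono) auto
    finally have "(1 + Y) powr (1 - s) / (1 - s) \<le> 2 powr 1 * Y powr (1 - s) / (1 - s)"
      using s by (intro divide_right_mono) auto
    hence "Q (1 + Y) \<le> 2 / (1 - s) * Y powr (1 - s)" by (simp add: Q_def)
    moreover have "Q 1 \<ge> 0" using s by (simp add: Q_def)
    ultimately show ?thesis by linarith
  qed
  finally show "norm (tail_int s y m K)
     \<le> (exp (1 + pi / 4) * (6 * (2 * (2 / (1 - s)) + sqrt 2))) * (1 / y powr ((1 - s) / 2))"
    unfolding Yp[symmetric] by (simp add: algebra_simps)
qed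

text \<open>Here the antiderivative is \<open>ln\<close>, and \<open>ln Y\<close> is half of
  \<open>ln (1 / y)\<close>.\<close>

lemma tail_int_bound_1:
  obtains C where "\<And>y m K. 0 < y \<Longrightarrow> y \<le> 1 \<Longrightarrow> real K \<le> y * real m \<Longrightarrow> y * real m \<le> real K + 1 \<Longrightarrow>
        norm (tail_int 1 y m K) \<le> C * (1 + ln (1 / y))"
proof (rule that)
  fix y :: real and m K :: nat
  assume y: "0 < y" "y \<le> 1" and K: "real K \<le> y * real m" "y * real m \<le> real K + 1"
  define Y where "Y = 1 / sqrt y"
  have Y: "Y \<ge> 1" using y by (simp add: Y_def)
  have L: "ln (1 / y) \<ge> 0" using y by simp
  have "(ln has_real_derivative x powr (- 1)) (at x)" if "x > 0" for x :: real
    using that by (auto intro!: derivative_eq_intros simp: powr_minus divide_inverse)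
  hence "norm (tail_int 1 y m K) \<le> exp (1 + pi / 4) * (6 * (2 * (ln (1 + Y) - ln 1) + sqrt 2 * Y powr (1 - 1)))"
    unfolding Y_def by (intro tail_int_antiderivative_bound y K) auto
  also have "\<dots> \<le> exp (1 + pi / 4) * (6 * (4 * (1 + ln (1 / y))))"
  proof (intro mult_left_mono)
    have "ln (1 + Y) \<le> ln (2 * Y)" using Y by (intro ln_mono) auto
    also have "\<dots> = ln 2 + ln Y" using Y by (simp add: ln_mult)
    also have "ln Y = ln (1 / y) / 2" using y by (simp add: Y_def ln_div ln_sqrt)
    finally have "ln (1 + Y) \<le> 1 + ln (1 / y) / 2" using ln_2_less_1 by linarith
    moreover have "sqrt 2 \<le> (2::real)" by (rule real_le_lsqrt) auto
    moreover have "Y powr (1 - 1) = 1" using Y by simp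
    ultimately show "2 * (ln (1 + Y) - ln 1) + sqrt 2 * Y powr (1 - 1) \<le> 4 * (1 + ln (1 / y))"
      using L by simp
  qed auto
  finally show "norm (tail_int 1 y m K) \<le> (exp (1 + pi / 4) * 24) * (1 + ln (1 / y))"
    by (simp add: algebra_simps)
qed

subsection \<open>Iteration along the orbit\<close>

lemma F_term_minus: "F_term s (- y) k = cnj (F_term s y k)"
  by (simp add: F_term_def exp_cnj)

lemma psum_minus: "psum s (- y) n = cnj (psum s y n)"
  by (simp add: psum_def F_term_minus)

text \<open>\<open>T y\<close> differs from \<open>- 1 / y\<close> by an even integer, which changes
  the exponent by an integer multiple of \<open>2 pi i\<close>. This is why \<open>T\<close> reduces
  modulo 2.\<close>

lemma F_term_T: "F_term s (T y) k = F_term s (- 1 / y) k"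
proof -
  define n where "n = \<lceil>(- 1 / y - 1) / 2\<rceil>"
  have T: "T y = - 1 / y - 2 * of_int n" by (simp add: T_def n_def)
  have "\<i> * of_real (pi * (real k)\<^sup>2 * T y)
     = \<i> * of_real (pi * (real k)\<^sup>2 * (- 1 / y)) + 2 * \<i> * of_real pi * of_int (- (int k)\<^sup>2 * n)"
    unfolding T by (simp add: algebra_simps)
  moreover have "exp (2 * \<i> * of_real pi * of_int (- (int k)\<^sup>2 * n)) = 1"
    using den_eq_0_iff[of "of_int (- (int k)\<^sup>2 * n)"] unfolding den_def by (metis Ints_of_int right_minus_eq)
  ultimately have "exp (\<i> * of_real (pi * (real k)\<^sup>2 * T y)) = exp (\<i> * of_real (pi * (real k)\<^sup>2 * (- 1 / y)))"
    by (simp only: exp_add mult_1_right)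
  thus ?thesis by (simp only: F_term_def)
qed

lemma psum_T: "psum s (T y) n = psum s (- 1 / y) n"
  by (simp only: psum_def F_term_T)

text \<open>The defect in the functional equation, for both signs of \<open>y\<close> and with
  \<open>T y\<close> in place of \<open>- 1 / y\<close>; the phase is \<open>rho\<close> or its
  conjugate. For \<open>m = 0\<close> both sums are empty and the defect vanishes.\<close>

definition gap :: "real \<Rightarrow> real \<Rightarrow> nat \<Rightarrow> complex" where
  "gap s y m = psum s y m - exp (\<i> * of_real (pi / 4 * sgn y)) * of_real (\<bar>y\<bar> powr (s - 1 / 2)) *
                psum s (T y) (nat \<lfloor>real m * \<bar>y\<bar>\<rfloor>)"

lemma gap_pos:
  assumes "y > 0"
  shows "gap s y m = psum s y m - rho * of_real (y powr (s - 1 / 2)) * psum s (- 1 / y) (nat \<lfloor>real m * y\<rfloor>)"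
  using assms by (simp add: gap_def rho_def psum_T)

text \<open>Conjugation flips the sign of \<open>y\<close>, as in the definition of
  \<open>Omega\<close>. The argument passes through \<open>- 1 / y\<close>, because
  \<open>T (- y) = - T y\<close> fails when \<open>T y = 1\<close>.\<close>

lemma gap_minus:
  assumes "y > 0"
  shows "gap s (- y) m = cnj (gap s y m)"
proof -
  have "exp (\<i> * of_real (pi / 4 * sgn (- y))) = cnj rho"
    using assms by (simp add: rho_def exp_cnj)
  moreover have "psum s (T (- y)) n = cnj (psum s (- 1 / y) n)" for n
    using psum_minus[of s "- 1 / y" n] by (simp add: psum_T)
  ultimately show ?thesis
    using assms by (simp add: gap_pos[OF assms]) (simp add: gap_def psum_minus)
qed

lemma gap_tendsto_Omega:
  assumes "y \<noteq> 0" "\<bar>y\<bar> \<le> 1" "0 < s" "s \<le> 1"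
  shows "gap s y \<longlonglongrightarrow> Omega s y"
proof (cases "y > 0")
  case True
  have "gap s y = (\<lambda>m. psum s y m - rho * of_real (y powr (s - 1 / 2)) * psum s (- 1 / y) (nat \<lfloor>real m * y\<rfloor>))"
    using gap_pos[OF True] by auto
  thus ?thesis using psum_approx_tendsto[of y s] True assms by (simp add: Omega_def)
next
  case False
  hence y: "- y > 0" using assms by simp
  have "(\<lambda>m. cnj (gap s (- y) m)) \<longlonglongrightarrow> cnj (I s (- y) 0)"
    using psum_approx_tendsto[of "- y" s] assms y by (intro tendsto_cnj) (simp add: gap_pos)
  moreover have "(\<lambda>m. cnj (gap s (- y) m)) = gap s y"
    using gap_minus[OF y, of s] by auto
  ultimately show ?thesis using y by (simp add: Omega_def)
qed

text \<open>The weight \<open>W\<close> stands for \<open>y powr (- (1 - s) / 2)\<close> if \<open>s < 1\<close> and for \<open>1 + ln (1 / y)\<close> if \<open>s = 1\<close>.\<close>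

lemma gap_bounded:
  assumes s: "0 < s" "s \<le> 1"
    and tail: "\<And>y m K. 0 < y \<Longrightarrow> y \<le> 1 \<Longrightarrow> real K \<le> y * real m \<Longrightarrow> y * real m \<le> real K + 1 \<Longrightarrow>
        norm (tail_int s y m K) \<le> C * W y"
    and W: "\<And>y. 0 < y \<Longrightarrow> y \<le> 1 \<Longrightarrow> 1 \<le> W y"
  obtains D where "\<And>y m. y \<noteq> 0 \<Longrightarrow> \<bar>y\<bar> \<le> 1 \<Longrightarrow> norm (gap s y m) \<le> D * W \<bar>y\<bar>"
proof -
  define Z where "Z = (\<Sum>k. 4 * sqrt 2 * real (Suc k) powr (- s - 1))"
  have sm: "summable (\<lambda>k. 4 * sqrt 2 * real (Suc k) powr (- s - 1))"
    by (rule summable_power_diff_bound[OF s(1)])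
  have Z0: "Z \<ge> 0" unfolding Z_def by (intro suminf_nonneg sm) auto
  have pos: "norm (gap s y m) \<le> (2 * C + Z) * W y" if y: "0 < y" "y \<le> 1" for y m
  proof -
    define K where "K = nat \<lfloor>real m * y\<rfloor>"
    have K: "real K \<le> y * m" "y * m \<le> real K + 1"
      using y by (auto simp: K_def mult.commute of_nat_nat intro: less_imp_le[OF real_of_int_floor_add_one_gt])
    define S where "S = (\<Sum>k<K. exp (- \<i> * of_real (pi * (real (Suc k))\<^sup>2 / y)) * power_diff_int s y (Suc k))"
    have "norm S \<le> (\<Sum>k<K. 4 * sqrt 2 * real (Suc k) powr (- s - 1))"
      unfolding S_def
    proof (rule sum_norm_le)
      fix k
      show "norm (exp (- \<i> * of_real (pi * (real (Suc k))\<^sup>2 / y)) * power_diff_int s y (Suc k))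
         \<le> 4 * sqrt 2 * real (Suc k) powr (- s - 1)"
        using norm_power_diff_int_le[of "Suc k" s y] s y by (simp add: norm_mult)
    qed
    also have "\<dots> \<le> Z" unfolding Z_def by (intro sum_le_suminf sm) auto
    finally have S: "norm S \<le> Z" .
    have "y powr s \<le> 1" using y s by (intro powr_le1) auto
    hence "y powr s * norm S \<le> 1 * Z" using S by (intro mult_mono) auto
    hence yS: "norm (rho * of_real (y powr s) * S) \<le> Z" by (simp add: norm_mult)
    have "gap s y m = tail_int s y 0 0 - tail_int s y m K + rho * of_real (y powr s) * S"
      unfolding gap_pos[OF y(1)] S_def K_def using s y by (intro psum_approx_functional_eq) auto
    also have "norm \<dots> \<le> norm (tail_int s y 0 0) + norm (tail_int s y m K) + norm (rho * of_real (y powr s) * S)"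
      by (intro order_trans[OF norm_triangle_ineq] add_mono norm_triangle_ineq4) auto
    \<comment> \<open>The lengths \<open>m = K = 0\<close> satisfy the condition of
      \<open>tail\<close>, so the first integral obeys the same bound.\<close>
    also have "norm (tail_int s y 0 0) \<le> C * W y" using y by (intro tail) auto
    also have "norm (tail_int s y m K) \<le> C * W y" using y K by (intro tail) auto
    also note yS
    \<comment> \<open>\<open>W y \<ge> 1\<close> absorbs the constant contribution of the
      series.\<close>
    also have "Z \<le> Z * W y" using mult_left_mono[OF W[OF y] Z0] by simp
    finally show ?thesis by (simp add: algebra_simps)
  qed
  show ?thesis
  proof (rule that)
    fix y :: real and m assume y: "y \<noteq> 0" "\<bar>y\<bar> \<le> 1"
    show "norm (gap s y m) \<le> (2 * C + Z) * W \<bar>y\<bar>"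
    proof (cases "y > 0")
      case False
      hence "- y > 0" using y by simp
      moreover from this have "\<bar>y\<bar> = - y" by simp
      ultimately show ?thesis using gap_minus[of "- y" s m] pos[of "- y" m] y by simp
    qed (use pos y in auto)
  qed
qed

section \<open>Orbits of irrational points and shrinking lengths\<close>

lemma T_irrational:
  assumes "y \<notin> \<rat>" shows "T y \<notin> \<rat>"
proof
  assume "T y \<in> \<rat>"
  hence "T y + 2 * of_int \<lceil>(- 1 / y - 1) / 2\<rceil> \<in> \<rat>" by auto
  hence "- 1 / y \<in> \<rat>" by (simp add: T_def)
  hence "inverse (- 1 / y) \<in> \<rat>" by (rule Rats_inverse)
  with assms show False by simp
qed

text \<open>Irrationality excludes the orbit points 0, where \<open>T\<close> is meaningless, and 1,
  so the orbit stays strictly inside the interval.\<close>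

lemma T_orbit:
  assumes "x \<in> {-1<..<1}" "x \<notin> \<rat>"
  shows "(T ^^ j) x \<notin> \<rat>" "\<bar>(T ^^ j) x\<bar> < 1" "(T ^^ j) x \<noteq> 0"
proof -
  show irr: "(T ^^ j) x \<notin> \<rat>" by (induction j) (auto simp: assms T_irrational)
  show "(T ^^ j) x \<noteq> 0" using irr by auto
  show "\<bar>(T ^^ j) x\<bar> < 1"
  proof (cases j)
    case (Suc i)
    have "(T ^^ j) x \<noteq> 1" using irr by auto
    thus ?thesis using T_range[of "(T ^^ i) x"] by (auto simp: Suc)
  qed (use assms in auto)
qed

text \<open>The length of the partial sum left after \<open>j\<close> applications of the functional
  equation to one of length \<open>n\<close>.\<close>

primrec orbit_index :: "real \<Rightarrow> nat \<Rightarrow> nat \<Rightarrow> nat" where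
  "orbit_index x n 0 = n"
| "orbit_index x n (Suc j) = nat \<lfloor>real (orbit_index x n j) * \<bar>(T ^^ j) x\<bar>\<rfloor>"

text \<open>As the orbit points have modulus below 1, rounding down a positive length loses at least
  1. Subtraction is truncated, so the length is 0 from \<open>j = n\<close> on and the iteration
  ends.\<close>

lemma orbit_index_le:
  assumes "x \<in> {-1<..<1}" "x \<notin> \<rat>"
  shows "orbit_index x n j \<le> n - j"
proof (induction j)
  case (Suc j)
  let ?i = "orbit_index x n j"
  have "orbit_index x n (Suc j) \<le> ?i - 1"
  proof (cases "?i = 0")
    case False
    hence "real ?i * \<bar>(T ^^ j) x\<bar> < real ?i * 1"
      using T_orbit[OF assms, of j] by (intro mult_strict_left_mono) auto
    hence "\<lfloor>real ?i * \<bar>(T ^^ j) x\<bar>\<rfloor> < int ?i" by linarith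
    thus ?thesis using False by simp
  qed simp
  with Suc show ?case by linarith
qed simp

text \<open>For fixed \<open>j\<close> each step only scales by a positive factor and rounds; this
  lets every single defect along the orbit reach its limit \<open>Omega\<close>.\<close>

lemma orbit_index_filterlim:
  assumes "x \<in> {-1<..<1}" "x \<notin> \<rat>"
  shows "filterlim (\<lambda>n. orbit_index x n j) sequentially sequentially"
proof (induction j)
  case 0
  thus ?case by (simp add: filterlim_ident)
next
  case (Suc j)
  define y where "y = \<bar>(T ^^ j) x\<bar>"
  have "y > 0" using T_orbit[OF assms, of j] by (simp add: y_def)
  hence "filterlim (\<lambda>m. nat \<lfloor>real m * y\<rfloor>) sequentially sequentially"
    by real_asymp
  from filterlim_compose[OF this Suc] show ?case by (simp add: y_def)
qed

text \<open>Unfolding \<open>gap\<close> repeatedly; the phases combine because their exponents add,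
  and the weights because \<open>powr\<close> is multiplicative on absolute values.\<close>

lemma psum_iterate:
  "psum s x n = (\<Sum>j<J. phase x j * of_real (\<bar>orbit_prod x j\<bar> powr (s - 1 / 2)) * gap s ((T ^^ j) x) (orbit_index x n j))
     + phase x J * of_real (\<bar>orbit_prod x J\<bar> powr (s - 1 / 2)) * psum s ((T ^^ J) x) (orbit_index x n J)"
proof (induction J)
  case 0
  show ?case by (simp add: phase_def orbit_prod_def)
next
  case (Suc J)
  define y i where "y = (T ^^ J) x" and "i = orbit_index x n J"
  have ph: "phase x (Suc J) = phase x J * exp (\<i> * of_real (pi / 4 * sgn y))"
    by (simp add: phase_def y_def ring_distribs exp_add)
  have op: "\<bar>orbit_prod x (Suc J)\<bar> powr (s - 1 / 2) = \<bar>orbit_prod x J\<bar> powr (s - 1 / 2) * \<bar>y\<bar> powr (s - 1 / 2)"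
    by (simp add: orbit_prod_def y_def abs_mult powr_mult)
  have "psum s y i = gap s y i + exp (\<i> * of_real (pi / 4 * sgn y)) * of_real (\<bar>y\<bar> powr (s - 1 / 2)) *
      psum s ((T ^^ Suc J) x) (orbit_index x n (Suc J))"
    by (simp add: gap_def y_def i_def)
  with Suc show ?case
    unfolding y_def[symmetric] i_def[symmetric] ph op
    by (simp add: algebra_simps flip: y_def i_def)
qed

text \<open>Tannery's theorem in the orbit position \<open>j\<close> as \<open>n\<close> grows: each
  term tends to its \<open>Omega\<close> term, and \<open>gap_bounded\<close> supplies a summable
  majorant uniform in \<open>n\<close>.\<close>

lemma F_orbit_expansion:
  assumes x: "x \<in> {-1<..<1}" "x \<notin> \<rat>" and s: "0 < s" "s \<le> 1"
    and tail: "\<And>y m K. 0 < y \<Longrightarrow> y \<le> 1 \<Longrightarrow> real K \<le> y * real m \<Longrightarrow> y * real m \<le> real K + 1 \<Longrightarrow>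
        norm (tail_int s y m K) \<le> C * W y"
    and W: "\<And>y. 0 < y \<Longrightarrow> y \<le> 1 \<Longrightarrow> 1 \<le> W y"
    and summ: "summable (\<lambda>j. \<bar>orbit_prod x j\<bar> powr (s - 1 / 2) * W \<bar>(T ^^ j) x\<bar>)"
  shows "F_convergent s x \<and>
    (\<lambda>j. phase x j * of_real (\<bar>orbit_prod x j\<bar> powr (s - 1 / 2)) * Omega s ((T ^^ j) x)) sums F s x"
proof -
  obtain D where D: "\<And>y m. y \<noteq> 0 \<Longrightarrow> \<bar>y\<bar> \<le> 1 \<Longrightarrow> norm (gap s y m) \<le> D * W \<bar>y\<bar>"
    using gap_bounded[OF s tail W] by blast
  define c where "c j = phase x j * of_real (\<bar>orbit_prod x j\<bar> powr (s - 1 / 2))" for j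
  define a where "a j n = c j * gap s ((T ^^ j) x) (orbit_index x n j)" for j n
  define b where "b j = c j * Omega s ((T ^^ j) x)" for j
  note orb = T_orbit[OF x]
  have nc: "norm (c j) = \<bar>orbit_prod x j\<bar> powr (s - 1 / 2)" for j
    by (simp add: c_def phase_def norm_mult)
  have psum_eq: "psum s x n = (\<Sum>j. a j n)" for n
  proof -
    have z: "psum s y 0 = 0" "gap s y 0 = 0" for y by (simp_all add: psum_def gap_def)
    have "orbit_index x n n = 0" using orbit_index_le[OF x, of n n] by simp
    hence "psum s x n = (\<Sum>j<n. a j n)"
      using psum_iterate[of s x n n] by (simp add: a_def c_def z)
    \<comment> \<open>For \<open>j \<ge> n\<close> the length is 0 and the defect vanishes, so the
      finite sum is a full series, as Tannery's theorem requires.\<close>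
    also have "\<dots> = (\<Sum>j. a j n)"
    proof (rule suminf_finite[symmetric])
      fix j assume "j \<notin> {..<n}"
      hence "orbit_index x n j = 0" using orbit_index_le[OF x, of n j] by simp
      thus "a j n = 0" by (simp add: a_def z)
    qed simp
    finally show ?thesis .
  qed
  have "eventually (\<lambda>n. summable (\<lambda>k. norm (a k n))) sequentially \<and>
           summable (\<lambda>n. norm (b n)) \<and> ((\<lambda>n. suminf (\<lambda>k. a k n)) \<longlonglongrightarrow> suminf b)"
  proof (rule tannerys_theorem)
    show "(\<lambda>n. a j n) \<longlonglongrightarrow> b j" for j
      unfolding a_def b_def using orb[of j] s
      by (intro tendsto_mult tendsto_const
            filterlim_compose[OF gap_tendsto_Omega orbit_index_filterlim[OF x]]) auto
    show "summable (\<lambda>j. D * (\<bar>orbit_prod x j\<bar> powr (s - 1 / 2) * W \<bar>(T ^^ j) x\<bar>))"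
      by (intro summable_mult summ)
    have "norm (a j n) \<le> D * (\<bar>orbit_prod x j\<bar> powr (s - 1 / 2) * W \<bar>(T ^^ j) x\<bar>)" for j n
    proof -
      have "norm (a j n) \<le> \<bar>orbit_prod x j\<bar> powr (s - 1 / 2) * (D * W \<bar>(T ^^ j) x\<bar>)"
        unfolding a_def norm_mult nc using orb[of j] by (intro mult_left_mono D) auto
      thus ?thesis by (simp add: mult_ac)
    qed
    thus "eventually (\<lambda>(j, n). norm (a j n) \<le> D * (\<bar>orbit_prod x j\<bar> powr (s - 1 / 2) * W \<bar>(T ^^ j) x\<bar>))
            (at_top \<times>\<^sub>F sequentially)"
      by (intro always_eventually) auto
  qed auto
  hence b: "summable b" and lim: "psum s x \<longlonglongrightarrow> suminf b"
    by (auto simp: psum_eq[abs_def] intro: summable_norm_cancel)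
  have "(\<lambda>k. F_term s x (Suc k)) sums suminf b"
    using lim by (simp add: sums_def psum_def[abs_def])
  hence "F_convergent s x" "F s x = suminf b"
    by (auto simp: F_convergent_def F_def sums_iff)
  thus ?thesis using summable_sums[OF b] by (simp add: b_def[abs_def] c_def)
qed

section \<open>The weights for \<open>s < 1\<close> and for \<open>s = 1\<close>\<close>

theorem theorem3:
  fixes x :: real
  assumes "x \<in> {-1<..<1}" and "x \<notin> \<rat>"
  shows "(\<forall>s::real. s \<in> {1/2<..<1} \<longrightarrow>
            summable (\<lambda>j. \<bar>orbit_prod x j\<bar> powr (s - 1/2) / \<bar>(T ^^ j) x\<bar> powr ((1 - s) / 2)) \<longrightarrow>
            F_convergent s x \<and>
            (\<lambda>j. phase x j * of_real (\<bar>orbit_prod x j\<bar> powr (s - 1/2)) * Omega s ((T ^^ j) x))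
              sums F s x)
       \<and> (summable (\<lambda>j. sqrt \<bar>orbit_prod x j\<bar>) \<longrightarrow>
          summable (\<lambda>j. sqrt \<bar>orbit_prod x j\<bar> * ln (1 / \<bar>(T ^^ j) x\<bar>)) \<longrightarrow>
            F_convergent 1 x \<and>
            (\<lambda>j. phase x j * of_real (sqrt \<bar>orbit_prod x j\<bar>) * Omega 1 ((T ^^ j) x))
              sums F 1 x)"
proof (intro conjI allI impI)
  fix s :: real
  assume s: "s \<in> {1/2<..<1}"
    and summ: "summable (\<lambda>j. \<bar>orbit_prod x j\<bar> powr (s - 1/2) / \<bar>(T ^^ j) x\<bar> powr ((1 - s) / 2))"
  obtain C where C: "\<And>y m K. 0 < y \<Longrightarrow> y \<le> 1 \<Longrightarrow> real K \<le> y * real m \<Longrightarrow> y * real m \<le> real K + 1 \<Longrightarrow>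
        norm (tail_int s y m K) \<le> C * (1 / y powr ((1 - s) / 2))"
    using tail_int_bound_less_1[of s] s by auto
  have W: "1 \<le> 1 / y powr ((1 - s) / 2)" if "0 < y" "y \<le> 1" for y
    using that s powr_le1[of "(1 - s) / 2" y] by (simp add: field_simps)
  have "F_convergent s x \<and>
    (\<lambda>j. phase x j * of_real (\<bar>orbit_prod x j\<bar> powr (s - 1/2)) * Omega s ((T ^^ j) x)) sums F s x"
    by (rule F_orbit_expansion[OF assms _ _ C W]) (use s summ in auto)
  thus "F_convergent s x"
    "(\<lambda>j. phase x j * of_real (\<bar>orbit_prod x j\<bar> powr (s - 1/2)) * Omega s ((T ^^ j) x)) sums F s x"
    by blast+
next
  assume summ: "summable (\<lambda>j. sqrt \<bar>orbit_prod x j\<bar>)"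
    "summable (\<lambda>j. sqrt \<bar>orbit_prod x j\<bar> * ln (1 / \<bar>(T ^^ j) x\<bar>))"
  obtain C where C: "\<And>y m K. 0 < y \<Longrightarrow> y \<le> 1 \<Longrightarrow> real K \<le> y * real m \<Longrightarrow> y * real m \<le> real K + 1 \<Longrightarrow>
        norm (tail_int 1 y m K) \<le> C * (1 + ln (1 / y))"
    using tail_int_bound_1 by auto
  have W: "1 \<le> 1 + ln (1 / y)" if "0 < y" "y \<le> 1" for y :: real
    using that by simp
  have p: "\<bar>orbit_prod x j\<bar> powr (1 - 1 / 2) = sqrt \<bar>orbit_prod x j\<bar>" for j
    by (simp add: powr_half_sqrt)
  \<comment> \<open>Adding the two hypotheses gives summability against the weight
    \<open>1 + ln (1 / y)\<close>.\<close>
  have "summable (\<lambda>j. \<bar>orbit_prod x j\<bar> powr (1 - 1 / 2) * (1 + ln (1 / \<bar>(T ^^ j) x\<bar>)))"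
    using summable_add[OF summ] unfolding p by (simp add: algebra_simps)
  hence "F_convergent 1 x \<and>
    (\<lambda>j. phase x j * of_real (\<bar>orbit_prod x j\<bar> powr (1 - 1/2)) * Omega 1 ((T ^^ j) x)) sums F 1 x"
    by (intro F_orbit_expansion[OF assms _ _ C W]) auto
  thus "F_convergent 1 x"
    "(\<lambda>j. phase x j * of_real (sqrt \<bar>orbit_prod x j\<bar>) * Omega 1 ((T ^^ j) x)) sums F 1 x"
    unfolding p by blast+
qed

end
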